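(* Let $\mathrm{Alt}$ be the operad of alternative algebras over a field $\Bbbk$. Then $\mathrm{Alt}$ does not admit a nonsymmetric version; more precisely, $$(\mathrm{As}\circ\mathrm{Alt})\big/\{g_1-h_2=0,\ g_2-h_1=0\}\not\cong\mathrm{Alt}.$$
   Context: **Alt.** $\mathrm{Alt}$ is the binary quadratic symmetric operad generated by one binary operation without symmetry, $e_1=x_1x_2$, $e_2=(12)e_1=x_2x_1$, with the multilinear identities $(x_1,x_2,x_3)+(x_2,x_1,x_3)=0$ and $(x_1,x_2,x_3)+(x_1,x_3,x_2)=0$, where $(a,b,c)=(ab)c-a(bc)$. **White Manin product with $\mathrm{As}$.** $\mathrm{As}$ is the (symmetric) operad of associative algebras. For a binary quadratic operad $\mathcal P$ generated by the $S_2$-module $V$ with basis $e_1=x_1\circ x_2$, $e_2=(12)e_1=x_2\circ x_1$, the white Manin product $\mathrm{As}\circ\mathcal P$ is the binary quadratic operad generated by $\mathrm{As}(2)\otimes V$ (diagonal $S_2$-action) whose space of relations is the kernel of the natural map $\mathcal F(3)\to\mathrm{As}(3)\otimes\mathcal P(3)$ induced by composing componentwise, where $\mathcal F$ is the free symmetric operad generated by $\mathrm{As}(2)\otimes V$ in arity 2. The space $\mathrm{As}(2)\otimes V$ has basis $h_1=x_1\prec x_2:=x_1x_2\otimes (x_1\circ x_2)$, $h_2=(12)h_1=x_2\prec x_1$, $g_1=x_1\succ x_2:=x_1x_2\otimes(x_2\circ x_1)$, $g_2=(12)g_1=x_2\succ x_1$. **Nonsymmetric version.** $\mathcal P$ admits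 a nonsymmetric version if $(\mathrm{As}\circ\mathcal P)/\{g_1-h_2=0,\ g_2-h_1=0\}\cong\mathcal P$ as operads. *)

theory Defs
  imports Complex_Main "HOL-Library.Poly_Mapping" "HOL-Combinatorics.Permutations"
begin

section \<open>Symmetric operads over a field\<close>

text \<open>
  The scalars are a type of class field, so that the free type variable \<open>'k\<close> plays the role
  of an arbitrary ground field. All components \<open>P(n)\<close> live in one ambient type \<open>'a\<close> and every
  operation carries the arities of its arguments. The partial composition
  \<open>ocomp P m i n x y\<close> is \<open>x \<circ>\<^sub>i y\<close> for \<open>x \<in> P(m)\<close>, \<open>y \<in> P(n)\<close>, with
  \<open>1 \<le> i \<le> m\<close>. Permutations are functions that permute \<open>{1..n}\<close>; they act from the left, by
  \<open>(\<sigma> x)(x\<^sub>1, \<dots>, x\<^sub>n) = x(x\<^bsub>\<sigma>(1)\<^esub>, \<dots>, x\<^bsub>\<sigma>(n)\<^esub>)\<close>.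
\<close>

record ('k, 'a) operad =
  ocarrier :: "nat \<Rightarrow> 'a set"
  ozero :: "nat \<Rightarrow> 'a"
  oadd :: "nat \<Rightarrow> 'a \<Rightarrow> 'a \<Rightarrow> 'a"
  oscale :: "nat \<Rightarrow> 'k \<Rightarrow> 'a \<Rightarrow> 'a"
  oact :: "nat \<Rightarrow> (nat \<Rightarrow> nat) \<Rightarrow> 'a \<Rightarrow> 'a"
  ounit :: "'a"
  ocomp :: "nat \<Rightarrow> nat \<Rightarrow> nat \<Rightarrow> 'a \<Rightarrow> 'a \<Rightarrow> 'a"

text \<open>
  The permutation of \<open>{1..m+n-1}\<close> with
  \<open>(\<sigma> x) \<circ>\<^bsub>\<sigma>(i)\<^esub> (\<tau> y) = block_perm m i n \<sigma> \<tau> (x \<circ>\<^sub>i y)\<close>: it permutes the block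
  \<open>{i..i+n-1}\<close> of inputs of \<open>y\<close> by \<open>\<tau>\<close> and moves it to the place prescribed by \<open>\<sigma>\<close>.
\<close>

definition block_perm ::
    "nat \<Rightarrow> nat \<Rightarrow> nat \<Rightarrow> (nat \<Rightarrow> nat) \<Rightarrow> (nat \<Rightarrow> nat) \<Rightarrow> nat \<Rightarrow> nat" where
  "block_perm m i n \<sigma> \<tau> k =
    (let place = (\<lambda>j. if j < \<sigma> i then j else j + n - 1) in
     if k < 1 \<or> m + n - 1 < k then k
     else if k < i then place (\<sigma> k)
     else if k < i + n then \<tau> (k + 1 - i) + \<sigma> i - 1
     else place (\<sigma> (k + 1 - n)))"

locale operad =
  fixes P :: "('k::field, 'a) operad"
  assumes zero_closed: "ozero P n \<in> ocarrier P n"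
    and add_closed: "\<lbrakk>x \<in> ocarrier P n; y \<in> ocarrier P n\<rbrakk> \<Longrightarrow> oadd P n x y \<in> ocarrier P n"
    and scale_closed: "x \<in> ocarrier P n \<Longrightarrow> oscale P n c x \<in> ocarrier P n"
    and add_assoc: "\<lbrakk>x \<in> ocarrier P n; y \<in> ocarrier P n; z \<in> ocarrier P n\<rbrakk> \<Longrightarrow>
      oadd P n (oadd P n x y) z = oadd P n x (oadd P n y z)"
    and add_commute: "\<lbrakk>x \<in> ocarrier P n; y \<in> ocarrier P n\<rbrakk> \<Longrightarrow> oadd P n x y = oadd P n y x"
    and add_zero: "x \<in> ocarrier P n \<Longrightarrow> oadd P n (ozero P n) x = x"
    and add_inverse: "x \<in> ocarrier P n \<Longrightarrow> oadd P n (oscale P n (- 1) x) x = ozero P n"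
    and scale_add_right: "\<lbrakk>x \<in> ocarrier P n; y \<in> ocarrier P n\<rbrakk> \<Longrightarrow>
      oscale P n c (oadd P n x y) = oadd P n (oscale P n c x) (oscale P n c y)"
    and scale_add_left: "x \<in> ocarrier P n \<Longrightarrow>
      oscale P n (c + d) x = oadd P n (oscale P n c x) (oscale P n d x)"
    and scale_scale: "x \<in> ocarrier P n \<Longrightarrow> oscale P n c (oscale P n d x) = oscale P n (c * d) x"
    and scale_one: "x \<in> ocarrier P n \<Longrightarrow> oscale P n 1 x = x"
    and act_closed: "\<lbrakk>\<sigma> permutes {1..n}; x \<in> ocarrier P n\<rbrakk> \<Longrightarrow> oact P n \<sigma> x \<in> ocarrier P n"
    and act_add: "\<lbrakk>\<sigma> permutes {1..n}; x \<in> ocarrier P n; y \<in> ocarrier P n\<rbrakk> \<Longrightarrow>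
      oact P n \<sigma> (oadd P n x y) = oadd P n (oact P n \<sigma> x) (oact P n \<sigma> y)"
    and act_scale: "\<lbrakk>\<sigma> permutes {1..n}; x \<in> ocarrier P n\<rbrakk> \<Longrightarrow>
      oact P n \<sigma> (oscale P n c x) = oscale P n c (oact P n \<sigma> x)"
    and act_id: "x \<in> ocarrier P n \<Longrightarrow> oact P n id x = x"
    and act_act: "\<lbrakk>\<sigma> permutes {1..n}; \<tau> permutes {1..n}; x \<in> ocarrier P n\<rbrakk> \<Longrightarrow>
      oact P n \<sigma> (oact P n \<tau> x) = oact P n (\<sigma> \<circ> \<tau>) x"
    and unit_closed: "ounit P \<in> ocarrier P 1"
    and comp_closed: "\<lbrakk>1 \<le> i; i \<le> m; x \<in> ocarrier P m; y \<in> ocarrier P n\<rbrakk> \<Longrightarrow>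
      ocomp P m i n x y \<in> ocarrier P (m + n - 1)"
    and comp_add_left: "\<lbrakk>1 \<le> i; i \<le> m; x \<in> ocarrier P m; x' \<in> ocarrier P m; y \<in> ocarrier P n\<rbrakk> \<Longrightarrow>
      ocomp P m i n (oadd P m x x') y
        = oadd P (m + n - 1) (ocomp P m i n x y) (ocomp P m i n x' y)"
    and comp_add_right: "\<lbrakk>1 \<le> i; i \<le> m; x \<in> ocarrier P m; y \<in> ocarrier P n; y' \<in> ocarrier P n\<rbrakk> \<Longrightarrow>
      ocomp P m i n x (oadd P n y y')
        = oadd P (m + n - 1) (ocomp P m i n x y) (ocomp P m i n x y')"
    and comp_scale_left: "\<lbrakk>1 \<le> i; i \<le> m; x \<in> ocarrier P m; y \<in> ocarrier P n\<rbrakk> \<Longrightarrow>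
      ocomp P m i n (oscale P m c x) y = oscale P (m + n - 1) c (ocomp P m i n x y)"
    and comp_scale_right: "\<lbrakk>1 \<le> i; i \<le> m; x \<in> ocarrier P m; y \<in> ocarrier P n\<rbrakk> \<Longrightarrow>
      ocomp P m i n x (oscale P n c y) = oscale P (m + n - 1) c (ocomp P m i n x y)"
    and unit_comp: "x \<in> ocarrier P n \<Longrightarrow> ocomp P 1 1 n (ounit P) x = x"
    and comp_unit: "\<lbrakk>1 \<le> i; i \<le> m; x \<in> ocarrier P m\<rbrakk> \<Longrightarrow> ocomp P m i 1 x (ounit P) = x"
    and comp_assoc: "\<lbrakk>1 \<le> i; i \<le> l; 1 \<le> j; j \<le> m;
        x \<in> ocarrier P l; y \<in> ocarrier P m; z \<in> ocarrier P n\<rbrakk> \<Longrightarrow>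
      ocomp P (l + m - 1) (i + j - 1) n (ocomp P l i m x y) z
        = ocomp P l i (m + n - 1) x (ocomp P m j n y z)"
    and comp_parallel: "\<lbrakk>1 \<le> i; i < k; k \<le> l;
        x \<in> ocarrier P l; y \<in> ocarrier P m; z \<in> ocarrier P n\<rbrakk> \<Longrightarrow>
      ocomp P (l + m - 1) (k + m - 1) n (ocomp P l i m x y) z
        = ocomp P (l + n - 1) i m (ocomp P l k n x z) y"
    and comp_equivariant: "\<lbrakk>1 \<le> i; i \<le> m; \<sigma> permutes {1..m}; \<tau> permutes {1..n};
        x \<in> ocarrier P m; y \<in> ocarrier P n\<rbrakk> \<Longrightarrow>
      ocomp P m (\<sigma> i) n (oact P m \<sigma> x) (oact P n \<tau> y)
        = oact P (m + n - 1) (block_perm m i n \<sigma> \<tau>) (ocomp P m i n x y)"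

definition operad_hom ::
    "('k, 'a) operad \<Rightarrow> ('k, 'b) operad \<Rightarrow> (nat \<Rightarrow> 'a \<Rightarrow> 'b) \<Rightarrow> bool" where
  "operad_hom P Q \<phi> \<longleftrightarrow>
    (\<forall>n. \<forall>x \<in> ocarrier P n. \<phi> n x \<in> ocarrier Q n) \<and>
    (\<forall>n. \<forall>x \<in> ocarrier P n. \<forall>y \<in> ocarrier P n. \<phi> n (oadd P n x y) = oadd Q n (\<phi> n x) (\<phi> n y)) \<and>
    (\<forall>n c. \<forall>x \<in> ocarrier P n. \<phi> n (oscale P n c x) = oscale Q n c (\<phi> n x)) \<and>
    (\<forall>n \<sigma>. \<forall>x \<in> ocarrier P n. \<sigma> permutes {1..n} \<longrightarrow> \<phi> n (oact P n \<sigma> x) = oact Q n \<sigma> (\<phi> n x)) \<and>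
    \<phi> 1 (ounit P) = ounit Q \<and>
    (\<forall>m n i. \<forall>x \<in> ocarrier P m. \<forall>y \<in> ocarrier P n. 1 \<le> i \<and> i \<le> m \<longrightarrow>
      \<phi> (m + n - 1) (ocomp P m i n x y) = ocomp Q m i n (\<phi> m x) (\<phi> n y))"

definition operad_iso :: "('k, 'a) operad \<Rightarrow> ('k, 'b) operad \<Rightarrow> bool"  (infix \<open>\<cong>\<^sub>o\<^sub>p\<close> 50) where
  "P \<cong>\<^sub>o\<^sub>p Q \<longleftrightarrow>
    (\<exists>\<phi>. operad_hom P Q \<phi> \<and> (\<forall>n. bij_betw (\<phi> n) (ocarrier P n) (ocarrier Q n)))"


section \<open>Ideals and quotients\<close>

definition operad_ideal :: "('k, 'a) operad \<Rightarrow> (nat \<Rightarrow> 'a set) \<Rightarrow> bool" where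
  "operad_ideal P I \<longleftrightarrow>
    (\<forall>n. I n \<subseteq> ocarrier P n) \<and>
    (\<forall>n. ozero P n \<in> I n) \<and>
    (\<forall>n. \<forall>x \<in> I n. \<forall>y \<in> I n. oadd P n x y \<in> I n) \<and>
    (\<forall>n c. \<forall>x \<in> I n. oscale P n c x \<in> I n) \<and>
    (\<forall>n \<sigma>. \<forall>x \<in> I n. \<sigma> permutes {1..n} \<longrightarrow> oact P n \<sigma> x \<in> I n) \<and>
    (\<forall>m n i. \<forall>x \<in> I m. \<forall>y \<in> ocarrier P n. 1 \<le> i \<and> i \<le> m \<longrightarrow> ocomp P m i n x y \<in> I (m + n - 1)) \<and>
    (\<forall>m n i. \<forall>x \<in> ocarrier P m. \<forall>y \<in> I n. 1 \<le> i \<and> i \<le> m \<longrightarrow> ocomp P m i n x y \<in> I (m + n - 1))"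

definition generated_ideal :: "('k, 'a) operad \<Rightarrow> (nat \<Rightarrow> 'a set) \<Rightarrow> nat \<Rightarrow> 'a set" where
  "generated_ideal P S n =
    {x \<in> ocarrier P n. \<forall>I. operad_ideal P I \<and> (\<forall>k. S k \<subseteq> I k) \<longrightarrow> x \<in> I n}"

definition ocoset :: "('k, 'a) operad \<Rightarrow> (nat \<Rightarrow> 'a set) \<Rightarrow> nat \<Rightarrow> 'a \<Rightarrow> 'a set" where
  "ocoset P I n x = oadd P n x ` I n"

text \<open>
  For an ideal \<open>I\<close> all cosets in each of the following unions coincide.
\<close>

definition quotient_operad ::
    "('k, 'a) operad \<Rightarrow> (nat \<Rightarrow> 'a set) \<Rightarrow> ('k, 'a set) operad"  (infixl \<open>'/'/\<^sub>o\<^sub>p\<close> 70) where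
  "P //\<^sub>o\<^sub>p I =
    \<lparr>ocarrier = (\<lambda>n. ocoset P I n ` ocarrier P n),
     ozero = (\<lambda>n. ocoset P I n (ozero P n)),
     oadd = (\<lambda>n A B. \<Union>x \<in> A. \<Union>y \<in> B. ocoset P I n (oadd P n x y)),
     oscale = (\<lambda>n c A. \<Union>x \<in> A. ocoset P I n (oscale P n c x)),
     oact = (\<lambda>n \<sigma> A. \<Union>x \<in> A. ocoset P I n (oact P n \<sigma> x)),
     ounit = ocoset P I 1 (ounit P),
     ocomp = (\<lambda>m i n A B. \<Union>x \<in> A. \<Union>y \<in> B. ocoset P I (m + n - 1) (ocomp P m i n x y))\<rparr>"


section \<open>Free operads on binary operations without symmetry\<close>

text \<open>
  A set of binary operations without symmetry spans a free \<open>S\<^sub>2\<close>-module, and the free symmetric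
  operad on it is spanned in arity \<open>n\<close> by the nonassociative monomials in which each of
  \<open>x\<^sub>1, \<dots>, x\<^sub>n\<close> occurs exactly once. \<open>Leaf j\<close> stands for \<open>x\<^sub>j\<close>.
\<close>

datatype 'x tree = Leaf nat | Node 'x "'x tree" "'x tree"

primrec leaves :: "'x tree \<Rightarrow> nat list" where
  "leaves (Leaf j) = [j]"
| "leaves (Node x l r) = leaves l @ leaves r"

primrec relabel :: "(nat \<Rightarrow> nat) \<Rightarrow> 'x tree \<Rightarrow> 'x tree" where
  "relabel f (Leaf j) = Leaf (f j)"
| "relabel f (Node x l r) = Node x (relabel f l) (relabel f r)"

primrec graft :: "nat \<Rightarrow> 'x tree \<Rightarrow> 'x tree \<Rightarrow> 'x tree" where
  "graft i (Leaf j) s =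
    (if j < i then Leaf j
     else if j = i then relabel (\<lambda>p. p + i - 1) s
     else Leaf (j + length (leaves s) - 1))"
| "graft i (Node x l r) s = Node x (graft i l s) (graft i r s)"

definition multilinear :: "nat \<Rightarrow> 'x tree set" where
  "multilinear n = {t. distinct (leaves t) \<and> set (leaves t) = {1..n}}"

definition fscale :: "'k::field \<Rightarrow> ('b \<Rightarrow>\<^sub>0 'k) \<Rightarrow> ('b \<Rightarrow>\<^sub>0 'k)" where
  "fscale c f = Poly_Mapping.map ((*) c) f"

lemma lookup_fscale [simp]: "Poly_Mapping.lookup (fscale c f) b = c * Poly_Mapping.lookup f b"
  by (simp add: fscale_def Poly_Mapping.map.rep_eq when_def)

interpretation free_space: vector_space fscale
  by unfold_locales (auto intro!: poly_mapping_eqI simp: lookup_add algebra_simps)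

abbreviation basis :: "'b \<Rightarrow> ('b \<Rightarrow>\<^sub>0 'k::field)" where
  "basis b \<equiv> Poly_Mapping.single b 1"

definition linear_extension :: "('b \<Rightarrow> ('c \<Rightarrow>\<^sub>0 'k)) \<Rightarrow> ('b \<Rightarrow>\<^sub>0 'k::field) \<Rightarrow> ('c \<Rightarrow>\<^sub>0 'k)" where
  "linear_extension g f = (\<Sum>b \<in> Poly_Mapping.keys f. fscale (Poly_Mapping.lookup f b) (g b))"

definition free_operad :: "('k::field, 'x tree \<Rightarrow>\<^sub>0 'k) operad" where
  "free_operad =
    \<lparr>ocarrier = (\<lambda>n. {f. Poly_Mapping.keys f \<subseteq> multilinear n}),
     ozero = (\<lambda>n. 0),
     oadd = (\<lambda>n. (+)),
     oscale = (\<lambda>n. fscale),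
     oact = (\<lambda>n \<sigma>. linear_extension (\<lambda>t. basis (relabel \<sigma> t))),
     ounit = basis (Leaf 1),
     ocomp = (\<lambda>m i n f g.
       linear_extension (\<lambda>t. linear_extension (\<lambda>s. basis (graft i t s)) g) f)\<rparr>"


section \<open>Binary quadratic operads\<close>

definition quadratic_ideal :: "('x tree \<Rightarrow>\<^sub>0 'k::field) set \<Rightarrow> nat \<Rightarrow> ('x tree \<Rightarrow>\<^sub>0 'k) set" where
  "quadratic_ideal R = generated_ideal free_operad (\<lambda>n. if n = 3 then R else {})"

definition quadratic_operad ::
    "('x tree \<Rightarrow>\<^sub>0 'k::field) set \<Rightarrow> ('k, ('x tree \<Rightarrow>\<^sub>0 'k) set) operad" where
  "quadratic_operad R = free_operad //\<^sub>o\<^sub>p quadratic_ideal R"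

definition quadratic_class ::
    "('x tree \<Rightarrow>\<^sub>0 'k::field) set \<Rightarrow> nat \<Rightarrow> ('x tree \<Rightarrow>\<^sub>0 'k) \<Rightarrow> ('x tree \<Rightarrow>\<^sub>0 'k) set" where
  "quadratic_class R = ocoset free_operad (quadratic_ideal R)"

text \<open>
  The element \<open>x\<^sub>i * x\<^sub>j\<close> for a generating operation \<open>*\<close>; \<open>binary a 2 1\<close> is the image of
  \<open>binary a 1 2\<close> under the transposition \<open>(12)\<close>.
\<close>

definition binary :: "'x \<Rightarrow> nat \<Rightarrow> nat \<Rightarrow> ('x tree \<Rightarrow>\<^sub>0 'k::field)" where
  "binary a i j = basis (Node a (Leaf i) (Leaf j))"

text \<open>Operads with a single generating operation are presented with the label type \<open>unit\<close>.\<close>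

definition associator :: "nat \<Rightarrow> nat \<Rightarrow> nat \<Rightarrow> (unit tree \<Rightarrow>\<^sub>0 'k::field)" where
  "associator i j k =
    basis (Node () (Node () (Leaf i) (Leaf j)) (Leaf k))
    - basis (Node () (Leaf i) (Node () (Leaf j) (Leaf k)))"

definition associative_relations :: "(unit tree \<Rightarrow>\<^sub>0 'k::field) set" where
  "associative_relations = {associator 1 2 3}"

definition alternative_relations :: "(unit tree \<Rightarrow>\<^sub>0 'k::field) set" where
  "alternative_relations =
    {associator 1 2 3 + associator 2 1 3, associator 1 2 3 + associator 1 3 2}"

definition As :: "('k::field, (unit tree \<Rightarrow>\<^sub>0 'k) set) operad" where
  "As = quadratic_operad associative_relations"

definition Alt :: "('k::field, (unit tree \<Rightarrow>\<^sub>0 'k) set) operad" where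
  "Alt = quadratic_operad alternative_relations"


section \<open>The white Manin product with As\<close>

text \<open>
  The tensor product \<open>P(n) \<otimes> Q(n)\<close> is the free vector space on \<open>P(n) \<times> Q(n)\<close> modulo the span of the
  bilinearity relations; \<open>tensor_class P Q n z\<close> is the coset of \<open>z\<close>.
\<close>

definition tensor_relations ::
    "('k::field, 'a) operad \<Rightarrow> ('k, 'b) operad \<Rightarrow> nat \<Rightarrow> (('a \<times> 'b) \<Rightarrow>\<^sub>0 'k) set" where
  "tensor_relations P Q n = free_space.span
    ({basis (oadd P n x x', y) - basis (x, y) - basis (x', y) | x x' y.
        x \<in> ocarrier P n \<and> x' \<in> ocarrier P n \<and> y \<in> ocarrier Q n} \<union>
     {basis (x, oadd Q n y y') - basis (x, y) - basis (x, y') | x y y'.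
        x \<in> ocarrier P n \<and> y \<in> ocarrier Q n \<and> y' \<in> ocarrier Q n} \<union>
     {basis (oscale P n c x, y) - fscale c (basis (x, y)) | c x y.
        x \<in> ocarrier P n \<and> y \<in> ocarrier Q n} \<union>
     {basis (x, oscale Q n c y) - fscale c (basis (x, y)) | c x y.
        x \<in> ocarrier P n \<and> y \<in> ocarrier Q n})"

definition tensor_class ::
    "('k::field, 'a) operad \<Rightarrow> ('k, 'b) operad \<Rightarrow> nat \<Rightarrow> (('a \<times> 'b) \<Rightarrow>\<^sub>0 'k) \<Rightarrow> (('a \<times> 'b) \<Rightarrow>\<^sub>0 'k) set" where
  "tensor_class P Q n z = (+) z ` tensor_relations P Q n"

text \<open>
  The value in an operad \<open>P\<close> of a tree monomial whose labels \<open>a\<close> are interpreted by \<open>g a \<in> P(2)\<close>: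
  first compose with the inputs numbered from left to right, then permute the inputs. This is
  the image of the monomial under the morphism from the free operad that extends \<open>g\<close>.
\<close>

primrec planar_value :: "('k, 'a) operad \<Rightarrow> ('x \<Rightarrow> 'a) \<Rightarrow> 'x tree \<Rightarrow> 'a" where
  "planar_value P g (Leaf j) = ounit P"
| "planar_value P g (Node a l r) =
    (let p = length (leaves l); q = length (leaves r) in
     ocomp P (q + 1) 1 p (ocomp P 2 2 q (g a) (planar_value P g r)) (planar_value P g l))"

definition tree_value :: "('k, 'a) operad \<Rightarrow> ('x \<Rightarrow> 'a) \<Rightarrow> 'x tree \<Rightarrow> 'a" where
  "tree_value P g t =
    (let n = length (leaves t) in
     oact P n (\<lambda>k. if 1 \<le> k \<and> k \<le> n then leaves t ! (k - 1) else k) (planar_value P g t))"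

text \<open>
  \<open>As(2) \<otimes> V\<close> is the free \<open>S\<^sub>2\<close>-module on \<open>h\<^sub>1 = x\<^sub>1 \<prec> x\<^sub>2\<close> and \<open>g\<^sub>1 = x\<^sub>1 \<succ> x\<^sub>2\<close>. The natural map sends a
  monomial in \<open>\<prec>\<close> and \<open>\<succ>\<close> to the tensor product of its values under the two components of
  \<open>x\<^sub>1 \<prec> x\<^sub>2 \<mapsto> x\<^sub>1x\<^sub>2 \<otimes> (x\<^sub>1 \<circ> x\<^sub>2)\<close> and \<open>x\<^sub>1 \<succ> x\<^sub>2 \<mapsto> x\<^sub>1x\<^sub>2 \<otimes> (x\<^sub>2 \<circ> x\<^sub>1)\<close>. Below, \<open>R\<close> is a set of quadratic
  relations presenting \<open>P\<close>, an operad with one generating operation \<open>\<circ>\<close>.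
\<close>

datatype manin_label = Prec | Succ

definition As_part :: "manin_label \<Rightarrow> (unit tree \<Rightarrow>\<^sub>0 'k::field) set" where
  "As_part a = quadratic_class associative_relations 2 (binary () 1 2)"

primrec second_part ::
    "(unit tree \<Rightarrow>\<^sub>0 'k::field) set \<Rightarrow> manin_label \<Rightarrow> (unit tree \<Rightarrow>\<^sub>0 'k) set" where
  "second_part R Prec = quadratic_class R 2 (binary () 1 2)"
| "second_part R Succ = quadratic_class R 2 (binary () 2 1)"

definition white_natural_map ::
    "(unit tree \<Rightarrow>\<^sub>0 'k::field) set \<Rightarrow> nat \<Rightarrow> (manin_label tree \<Rightarrow>\<^sub>0 'k) \<Rightarrow>
     (((unit tree \<Rightarrow>\<^sub>0 'k) set \<times> (unit tree \<Rightarrow>\<^sub>0 'k) set) \<Rightarrow>\<^sub>0 'k) set" where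
  "white_natural_map R n f =
    tensor_class As (quadratic_operad R) n
      (linear_extension
        (\<lambda>t. basis (tree_value As As_part t, tree_value (quadratic_operad R) (second_part R) t)) f)"

definition white_relations :: "(unit tree \<Rightarrow>\<^sub>0 'k::field) set \<Rightarrow> (manin_label tree \<Rightarrow>\<^sub>0 'k) set" where
  "white_relations R =
    {f \<in> ocarrier free_operad 3.
       white_natural_map R 3 f = tensor_class As (quadratic_operad R) 3 0}"

definition white_As ::
    "(unit tree \<Rightarrow>\<^sub>0 'k::field) set \<Rightarrow> ('k, (manin_label tree \<Rightarrow>\<^sub>0 'k) set) operad" where
  "white_As R = quadratic_operad (white_relations R)"


section \<open>Nonsymmetric versions\<close>

text \<open>The images of \<open>g\<^sub>1 - h\<^sub>2\<close> and \<open>g\<^sub>2 - h\<^sub>1\<close> in the white product.\<close>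

definition symmetry_relations ::
    "(unit tree \<Rightarrow>\<^sub>0 'k::field) set \<Rightarrow> nat \<Rightarrow> (manin_label tree \<Rightarrow>\<^sub>0 'k) set set" where
  "symmetry_relations R n =
    (if n = 2 then
       {quadratic_class (white_relations R) 2 (binary Succ 1 2 - binary Prec 2 1),
        quadratic_class (white_relations R) 2 (binary Succ 2 1 - binary Prec 1 2)}
     else {})"

definition white_As_quotient ::
    "(unit tree \<Rightarrow>\<^sub>0 'k::field) set \<Rightarrow> ('k, (manin_label tree \<Rightarrow>\<^sub>0 'k) set set) operad" where
  "white_As_quotient R = white_As R //\<^sub>o\<^sub>p generated_ideal (white_As R) (symmetry_relations R)"

definition admits_nonsymmetric_version :: "(unit tree \<Rightarrow>\<^sub>0 'k::field) set \<Rightarrow> bool" where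
  "admits_nonsymmetric_version R \<longleftrightarrow> white_As_quotient R \<cong>\<^sub>o\<^sub>p quadratic_operad R"



section \<open>Well-definedness of the constructions\<close>

text \<open>
  The free operads, the quotients by ideals, and hence all structures compared above satisfy the
  operad axioms; every morphism out of a free operad is given by \<open>tree_value\<close>.
\<close>

lemma keys_fscale: "Poly_Mapping.keys (fscale c f) \<subseteq> Poly_Mapping.keys f"
  by (auto simp: in_keys_iff)

lemma fscale_basis: "fscale c (basis b) = Poly_Mapping.single b c"
  by (rule poly_mapping_eqI) (simp add: lookup_single when_def)

lemma linear_extension_sum:
  assumes "finite A" "Poly_Mapping.keys f \<subseteq> A"
  shows "linear_extension g f = (\<Sum>b\<in>A. fscale (Poly_Mapping.lookup f b) (g b))"
  unfolding linear_extension_def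
  by (rule sum.mono_neutral_left) (use assms in \<open>auto simp: in_keys_iff\<close>)

lemma linear_extension_add [simp]:
  "linear_extension g (f + f') = linear_extension g f + linear_extension g f'"
proof -
  let ?A = "Poly_Mapping.keys f \<union> Poly_Mapping.keys f'"
  have "Poly_Mapping.keys (f + f') \<subseteq> ?A" by (rule Poly_Mapping.keys_add)
  then show ?thesis
    by (simp add: linear_extension_sum[where A = ?A] lookup_add free_space.scale_left_distrib sum.distrib)
qed

lemma linear_extension_fscale [simp]:
  "linear_extension g (fscale c f) = fscale c (linear_extension g f)"
  by (simp add: linear_extension_sum[where A = "Poly_Mapping.keys f"] keys_fscale free_space.scale_sum_right)

lemma linear_extension_zero [simp]: "linear_extension g 0 = 0"
  by (simp add: linear_extension_def)

lemma linear_extension_basis [simp]: "linear_extension g (basis b) = g b"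
  by (simp add: linear_extension_def)

lemma linear_extension_single [simp]: "linear_extension g (Poly_Mapping.single b c) = fscale c (g b)"
  by (metis fscale_basis linear_extension_basis linear_extension_fscale)

lemma linear_extension_fun_add:
  "linear_extension (\<lambda>b. g b + h b) f = linear_extension g f + linear_extension h f"
  by (simp add: linear_extension_def free_space.scale_right_distrib sum.distrib)

lemma linear_extension_fun_scale:
  "linear_extension (\<lambda>b. fscale c (g b)) f = fscale c (linear_extension g f)"
  by (simp add: linear_extension_def free_space.scale_sum_right mult.commute)

lemma keys_linear_extension:
  assumes "\<And>b. b \<in> Poly_Mapping.keys f \<Longrightarrow> Poly_Mapping.keys (g b) \<subseteq> A"
  shows "Poly_Mapping.keys (linear_extension g f) \<subseteq> A"
proof -
  have "Poly_Mapping.keys (linear_extension g f) \<subseteq> (\<Union>b\<in>Poly_Mapping.keys f. Poly_Mapping.keys (fscale (Poly_Mapping.lookup f b) (g b)))"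
    unfolding linear_extension_def by (rule Poly_Mapping.keys_sum)
  also have "\<dots> \<subseteq> A"
    by (rule UN_least) (rule subset_trans[OF keys_fscale assms])
  finally show ?thesis .
qed

lemma free_induct [consumes 1, case_names zero basis add scale]:
  assumes "Poly_Mapping.keys f \<subseteq> A"
    and "Q 0"
    and "\<And>t. t \<in> A \<Longrightarrow> Q (basis t)"
    and "\<And>f g. Poly_Mapping.keys f \<subseteq> A \<Longrightarrow> Poly_Mapping.keys g \<subseteq> A \<Longrightarrow> Q f \<Longrightarrow> Q g \<Longrightarrow> Q (f + g)"
    and "\<And>f c. Poly_Mapping.keys f \<subseteq> A \<Longrightarrow> Q f \<Longrightarrow> Q (fscale c f)"
  shows "Q f"
proof -
  have "finite B \<Longrightarrow> B \<subseteq> A \<Longrightarrow> Q (\<Sum>b\<in>B. fscale (Poly_Mapping.lookup f b) (basis b)) \<and>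
     Poly_Mapping.keys (\<Sum>b\<in>B. fscale (Poly_Mapping.lookup f b) (basis b)) \<subseteq> A" for B
  proof (induction B rule: finite_induct)
    case empty then show ?case using assms by simp
  next
    case (insert b B)
    have k: "Poly_Mapping.keys (fscale (Poly_Mapping.lookup f b) (basis b)) \<subseteq> A"
      using insert keys_fscale[of "Poly_Mapping.lookup f b" "basis b"] by auto
    have q: "Q (fscale (Poly_Mapping.lookup f b) (basis b))"
      using insert assms by simp
    have "Poly_Mapping.keys (fscale (Poly_Mapping.lookup f b) (basis b) + (\<Sum>b\<in>B. fscale (Poly_Mapping.lookup f b) (basis b))) \<subseteq> A"
      using Poly_Mapping.keys_add k insert by fast
    then show ?case using k q insert assms(4) by simp
  qed
  moreover have "f = (\<Sum>b\<in>Poly_Mapping.keys f. fscale (Poly_Mapping.lookup f b) (basis b))"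
  proof (rule poly_mapping_eqI)
    fix k
    show "Poly_Mapping.lookup f k = Poly_Mapping.lookup (\<Sum>b\<in>Poly_Mapping.keys f. fscale (Poly_Mapping.lookup f b) (basis b)) k"
      by (cases "k \<in> Poly_Mapping.keys f")
        (simp_all add: fscale_basis lookup_sum lookup_single when_def in_keys_iff)
  qed
  ultimately show ?thesis using assms(1) by (metis finite_keys)
qed

lemma leaves_relabel [simp]: "leaves (relabel f t) = map f (leaves t)"
  by (induction t) auto

lemma relabel_relabel [simp]: "relabel f (relabel g t) = relabel (f \<circ> g) t"
  by (induction t) auto

lemma relabel_cong: "(\<And>j. j \<in> set (leaves t) \<Longrightarrow> f j = g j) \<Longrightarrow> relabel f t = relabel g t"
  by (induction t) auto

lemma relabel_id [simp]: "relabel id t = t"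
  by (induction t) auto

lemma length_leaves: "t \<in> multilinear n \<Longrightarrow> length (leaves t) = n"
  unfolding multilinear_def by (auto dest: distinct_card)

lemma leaves_nonempty: "leaves t \<noteq> []"
  by (induction t) auto

lemma set_graft:
  assumes "s \<in> multilinear n" "1 \<le> i"
  shows "set (leaves (graft i t s)) =
    (\<Union>j\<in>set (leaves t). if j < i then {j} else if j = i then {i..<i+n} else {j+n-1})"
proof (induction t)
  case (Leaf j)
  have "(\<lambda>p. p + i - 1) ` {1..n} = {i..<i+n}"
  proof (intro set_eqI iffI)
    fix x assume "x \<in> {i..<i+n}"
    then have "x = (x + 1 - i) + i - 1" "x + 1 - i \<in> {1..n}" using assms by auto
    then show "x \<in> (\<lambda>p. p + i - 1) ` {1..n}" by blast
  qed (use assms in auto)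
  then show ?case using assms length_leaves[OF assms(1)] by (auto simp: multilinear_def)
qed auto

lemma multilinear_pos: "s \<in> multilinear n \<Longrightarrow> 1 \<le> n"
  using leaves_nonempty[of s] length_leaves[of s n] by (cases n) auto

lemma disjoint_UN:
  "A \<inter> B = {} \<Longrightarrow> (\<And>k a b. k \<in> G a \<Longrightarrow> k \<in> G b \<Longrightarrow> a = b) \<Longrightarrow> (\<Union>a\<in>A. G a) \<inter> (\<Union>b\<in>B. G b) = {}"
  by fast

lemma distinct_graft:
  assumes "s \<in> multilinear n" "1 \<le> i" "distinct (leaves t)"
  shows "distinct (leaves (graft i t s))"
  using assms(3)
proof (induction t)
  case (Leaf j)
  then show ?case using assms by (auto simp: multilinear_def distinct_map inj_on_def)
next
  case (Node x l r)
  have n: "1 \<le> n" using assms multilinear_pos by blast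
  have "set (leaves (graft i l s)) \<inter> set (leaves (graft i r s)) = {}"
  proof -
    have "set (leaves l) \<inter> set (leaves r) = {}" using Node by auto
    moreover have "a = b" if "k \<in> (if a < i then {a} else if a = i then {i..<i+n} else {a+n-1})"
        "k \<in> (if b < i then {b} else if b = i then {i..<i+n} else {b+n-1})" for a b k
      using that n assms(2) by (auto split: if_splits)
    ultimately show ?thesis
      unfolding set_graft[OF assms(1,2)] by (rule disjoint_UN)
  qed
  then show ?case using Node by auto
qed

lemma graft_multilinear:
  assumes "t \<in> multilinear m" "s \<in> multilinear n" "1 \<le> i" "i \<le> m"
  shows "graft i t s \<in> multilinear (m + n - 1)"
proof -
  have n: "1 \<le> n" using assms multilinear_pos by blast
  have "(\<Union>j\<in>{1..m}. if j < i then {j} else if j = i then {i..<i+n} else {j+n-1}) = {1..m + n - 1}" (is "?L = ?R")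
  proof (intro set_eqI iffI)
    fix k assume k: "k \<in> ?R"
    consider "k < i" | "i \<le> k" "k < i + n" | "i + n \<le> k" by linarith
    then show "k \<in> ?L"
    proof cases
      case 1 then show ?thesis using k assms by (intro UN_I[of k]) auto
    next
      case 2 then show ?thesis using k assms by (intro UN_I[of i]) auto
    next
      case 3 then show ?thesis using k assms n by (intro UN_I[of "k + 1 - n"]) auto
    qed
  qed (use assms n in \<open>auto split: if_splits\<close>)
  then show ?thesis
    using set_graft[OF assms(2,3), of t] distinct_graft[OF assms(2,3), of t] assms(1)
    by (auto simp: multilinear_def)
qed

lemma relabel_multilinear:
  "\<sigma> permutes {1..n} \<Longrightarrow> t \<in> multilinear n \<Longrightarrow> relabel \<sigma> t \<in> multilinear n"
  using permutes_image[of \<sigma> "{1..n}"] permutes_inj_on[of \<sigma> "{1..n}" "{1..n}"]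
  unfolding multilinear_def by (simp add: distinct_map)

lemma length_graft:
  assumes "t \<in> multilinear m" "s \<in> multilinear n" "1 \<le> i" "i \<le> m"
  shows "length (leaves (graft i t s)) = m + n - 1"
  using length_leaves[OF graft_multilinear[OF assms]] .

lemma graft_relabel_high:
  assumes "\<And>j. j \<in> set (leaves t) \<Longrightarrow> 1 \<le> j" "1 \<le> i" "1 \<le> j"
  shows "graft (i + j - 1) (relabel (\<lambda>p. p + i - 1) t) s = relabel (\<lambda>p. p + i - 1) (graft j t s)"
  using assms(1)
proof (induction t)
  case (Leaf p)
  have "(\<lambda>q. q + (i + j - 1) - 1) = (\<lambda>q. q + i - 1) \<circ> (\<lambda>q. q + j - 1)"
    using assms by (auto simp: fun_eq_iff)
  moreover have "p + i - 1 < i + j - 1 \<longleftrightarrow> p < j" "p + i - 1 = i + j - 1 \<longleftrightarrow> p = j"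
    using assms Leaf by auto
  ultimately show ?case using assms leaves_nonempty[of s] by (cases "leaves s") auto
next
  case (Node x l r)
  then show ?case by simp
qed

lemma graft_notin:
  assumes "\<And>j. j \<in> set (leaves t) \<Longrightarrow> j < i" shows "graft i t s = t"
  using assms by (induction t) auto

lemma graft_notin':
  assumes "\<And>j. j \<in> set (leaves t) \<Longrightarrow> i < j" shows "graft i t s = relabel (\<lambda>p. p + length (leaves s) - 1) t"
  using assms by (induction t) auto

lemma graft_assoc:
  assumes x: "x \<in> multilinear l" and y: "y \<in> multilinear m" and z: "z \<in> multilinear n"
    and ij: "1 \<le> i" "i \<le> l" "1 \<le> j" "j \<le> m"
  shows "graft (i + j - 1) (graft i x y) z = graft i x (graft j y z)"
proof -
  have m: "1 \<le> m" and n: "1 \<le> n" using multilinear_pos y z by auto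
  have ys: "set (leaves y) = {1..m}" using y by (auto simp: multilinear_def)
  have "(\<And>p. p \<in> set (leaves x) \<Longrightarrow> 1 \<le> p) \<Longrightarrow> ?thesis"
  proof (induction x)
    case (Leaf p)
    have *: "graft (i + j - 1) (relabel (\<lambda>p. p + i - 1) y) z = relabel (\<lambda>p. p + i - 1) (graft j y z)"
      by (rule graft_relabel_high) (use ys ij in auto)
    show ?case using * ij m n length_leaves[OF y] length_leaves[OF z] length_graft[OF y z ij(3,4)] 
      by auto
  qed auto
  then show ?thesis using x by (auto simp: multilinear_def)
qed

lemma graft_parallel:
  assumes x: "x \<in> multilinear l" and y: "y \<in> multilinear m" and z: "z \<in> multilinear n"
    and ij: "1 \<le> i" "i < k" "k \<le> l"
  shows "graft (k + m - 1) (graft i x y) z = graft i (graft k x z) y"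
proof -
  have m: "1 \<le> m" and n: "1 \<le> n" using multilinear_pos y z by auto
  have ys: "set (leaves y) = {1..m}" "set (leaves z) = {1..n}" using y z by (auto simp: multilinear_def)
  show ?thesis
  proof (induction x)
    case (Leaf p)
    have 1: "graft (k + m - 1) (relabel (\<lambda>p. p + i - 1) y) z = relabel (\<lambda>p. p + i - 1) y"
      by (rule graft_notin) (use ys ij in auto)
    have 2: "graft i (relabel (\<lambda>p. p + k - 1) z) y = relabel (\<lambda>p. p + m - 1) (relabel (\<lambda>p. p + k - 1) z)"
      by (subst graft_notin') (use ys ij length_leaves[OF y] in auto)
    have 3: "relabel (\<lambda>q. q + (k + m - 1) - 1) z = relabel (\<lambda>p. p + m - 1) (relabel (\<lambda>p. p + k - 1) z)"
      unfolding relabel_relabel by (rule relabel_cong) (use ys ij m in auto)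
    consider "p < i" | "p = i" | "i < p" "p < k" | "p = k" | "k < p" by linarith
    then show ?case
    proof cases
      case 2 then show ?thesis using 1 ij by simp
    next
      case 4 then show ?thesis using 2 3 ij m length_leaves[OF y] by simp
    next
      case 1
      then have "p < k + m - 1" "p < k" using ij m by linarith+
      then show ?thesis using 1 ij by simp
    next
      case 3
      then have "p + m - 1 < k + m - 1" "\<not> p < i" "p \<noteq> i" "p \<noteq> k" using ij m by linarith+
      then show ?thesis using 3 length_leaves[OF y] by simp
    next
      case 5
      then have "\<not> p < i" "p \<noteq> i" "\<not> p < k" "p \<noteq> k" "\<not> p + m - 1 < k + m - 1" "p + m - 1 \<noteq> k + m - 1"
        "\<not> p + n - 1 < i" "p + n - 1 \<noteq> i" "p + m - 1 + n - 1 = p + n - 1 + m - 1" using ij m n by linarith+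
      then show ?thesis using length_leaves[OF y] length_leaves[OF z] by simp
    qed
  qed auto
qed

lemma graft_equivariant:
  assumes x: "x \<in> multilinear m" and y: "y \<in> multilinear n"
    and i: "1 \<le> i" "i \<le> m" and s: "\<sigma> permutes {1..m}" and t: "\<tau> permutes {1..n}"
  shows "graft (\<sigma> i) (relabel \<sigma> x) (relabel \<tau> y) = relabel (block_perm m i n \<sigma> \<tau>) (graft i x y)"
proof -
  have n: "1 \<le> n" using multilinear_pos y by auto
  have ys: "set (leaves y) = {1..n}" using y by (auto simp: multilinear_def)
  have inj: "\<sigma> a = \<sigma> b \<longleftrightarrow> a = b" for a b using permutes_inj[OF s] by (auto dest: injD)
  have si: "1 \<le> \<sigma> i" "\<sigma> i \<le> m" using permutes_in_image[OF s, of i] i by auto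
  have "(\<And>p. p \<in> set (leaves x) \<Longrightarrow> 1 \<le> p \<and> p \<le> m) \<Longrightarrow> ?thesis"
  proof (induction x)
    case (Leaf p)
    then have p: "1 \<le> p" "p \<le> m" by auto
    consider "p < i" | "p = i" | "i < p" by linarith
    then show ?case
    proof cases
      case 1
      then show ?thesis using p i n inj[of p i] length_leaves[OF y]
        by (auto simp: block_perm_def Let_def)
    next
      case 2
      have "relabel (\<lambda>p. p + \<sigma> i - 1) (relabel \<tau> y) = relabel (block_perm m i n \<sigma> \<tau>) (relabel (\<lambda>p. p + i - 1) y)"
        unfolding relabel_relabel
        by (rule relabel_cong) (use ys i in \<open>auto simp: block_perm_def Let_def\<close>)
      then show ?thesis using 2 by simp
    next
      case 3
      then show ?thesis using p i n inj[of p i] length_leaves[OF y]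
        by (auto simp: block_perm_def Let_def)
    qed
  qed auto
  then show ?thesis using x by (auto simp: multilinear_def)
qed

definition free_comp :: "nat \<Rightarrow> ('x tree \<Rightarrow>\<^sub>0 'k::field) \<Rightarrow> ('x tree \<Rightarrow>\<^sub>0 'k) \<Rightarrow> ('x tree \<Rightarrow>\<^sub>0 'k)" where
  "free_comp i f g = linear_extension (\<lambda>t. linear_extension (\<lambda>s. basis (graft i t s)) g) f"

lemma free_comp_simps [simp]:
  "free_comp i (f + f') g = free_comp i f g + free_comp i f' g"
  "free_comp i f (g + g') = free_comp i f g + free_comp i f g'"
  "free_comp i (fscale c f) g = fscale c (free_comp i f g)"
  "free_comp i f (fscale c g) = fscale c (free_comp i f g)"
  "free_comp i 0 g = 0" "free_comp i f 0 = 0"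
  "free_comp i (basis t) (basis s) = basis (graft i t s)"
proof -
  show "free_comp i f 0 = 0" by (simp add: free_comp_def) (simp add: linear_extension_def)
qed (simp_all add: free_comp_def linear_extension_fun_add linear_extension_fun_scale)

lemma free_operad_simps:
  "ocarrier free_operad n = {f. Poly_Mapping.keys f \<subseteq> multilinear n}"
  "ozero free_operad n = 0"
  "oadd free_operad n f g = f + g"
  "oscale free_operad n c f = fscale c f"
  "oact free_operad n \<sigma> f = linear_extension (\<lambda>t. basis (relabel \<sigma> t)) f"
  "ounit free_operad = basis (Leaf 1)"
  "ocomp free_operad m i n f g = free_comp i f g"
  by (simp_all add: free_operad_def free_comp_def)

lemma keys_free_comp:
  assumes "Poly_Mapping.keys f \<subseteq> multilinear m" "Poly_Mapping.keys g \<subseteq> multilinear n" "1 \<le> i" "i \<le> m"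
  shows "Poly_Mapping.keys (free_comp i f g) \<subseteq> multilinear (m + n - 1)"
  unfolding free_comp_def
proof (intro keys_linear_extension)
  fix t s assume "t \<in> Poly_Mapping.keys f" "s \<in> Poly_Mapping.keys g"
  then have "graft i t s \<in> multilinear (m + n - 1)"
    using graft_multilinear assms by blast
  then show "Poly_Mapping.keys (basis (graft i t s)) \<subseteq> multilinear (m + n - 1)" by simp
qed

lemma free_comp_assoc:
  fixes x y z :: "'x tree \<Rightarrow>\<^sub>0 'k::field"
  assumes "Poly_Mapping.keys x \<subseteq> multilinear l" "Poly_Mapping.keys y \<subseteq> multilinear m"
    "Poly_Mapping.keys z \<subseteq> multilinear n" "1 \<le> i" "i \<le> l" "1 \<le> j" "j \<le> m"
  shows "free_comp (i + j - 1) (free_comp i x y) z = free_comp i x (free_comp j y z)"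
  using assms(1)
proof (induction x rule: free_induct)
  case (basis t)
  note t = basis
  show ?case using assms(2)
  proof (induction y rule: free_induct)
    case (basis s)
    note s = basis
    show ?case using assms(3)
    proof (induction z rule: free_induct)
      case (basis u)
      then show ?case using graft_assoc[OF t s basis] assms by simp
    qed simp_all
  qed simp_all
qed simp_all

lemma free_comp_parallel:
  fixes x y z :: "'x tree \<Rightarrow>\<^sub>0 'k::field"
  assumes "Poly_Mapping.keys x \<subseteq> multilinear l" "Poly_Mapping.keys y \<subseteq> multilinear m"
    "Poly_Mapping.keys z \<subseteq> multilinear n" "1 \<le> i" "i < k" "k \<le> l"
  shows "free_comp (k + m - 1) (free_comp i x y) z = free_comp i (free_comp k x z) y"
  using assms(1)
proof (induction x rule: free_induct)
  case (basis t)
  note t = basis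
  show ?case using assms(2)
  proof (induction y rule: free_induct)
    case (basis s)
    note s = basis
    show ?case using assms(3)
    proof (induction z rule: free_induct)
      case (basis u)
      then show ?case using graft_parallel[OF t s basis] assms by simp
    qed simp_all
  qed simp_all
qed simp_all

lemma free_comp_equivariant:
  fixes x y :: "'x tree \<Rightarrow>\<^sub>0 'k::field"
  assumes "Poly_Mapping.keys x \<subseteq> multilinear m" "Poly_Mapping.keys y \<subseteq> multilinear n"
    "1 \<le> i" "i \<le> m" "\<sigma> permutes {1..m}" "\<tau> permutes {1..n}"
  shows "free_comp (\<sigma> i) (linear_extension (\<lambda>t. basis (relabel \<sigma> t)) x) (linear_extension (\<lambda>t. basis (relabel \<tau> t)) y)
    = linear_extension (\<lambda>t. basis (relabel (block_perm m i n \<sigma> \<tau>) t)) (free_comp i x y)"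
  using assms(1)
proof (induction x rule: free_induct)
  case (basis t)
  note t = basis
  show ?case using assms(2)
  proof (induction y rule: free_induct)
    case (basis s)
    then show ?case using graft_equivariant[OF t basis] assms by simp
  qed simp_all
qed simp_all

lemma graft_unit: "t \<in> multilinear n \<Longrightarrow> graft 1 (Leaf 1) t = t"
  by (simp add: relabel_cong[of t "\<lambda>p. p" id])

lemma graft_unit': "graft i t (Leaf 1) = t"
  by (induction t) auto

lemma relabel_ident: "relabel (\<lambda>a. a) t = t"
  by (induction t) auto

lemma operad_free: "operad (free_operad :: ('k::field, 'x tree \<Rightarrow>\<^sub>0 'k) operad)"
proof (unfold_locales, unfold free_operad_simps mem_Collect_eq)
  fix n :: nat and x y :: "'x tree \<Rightarrow>\<^sub>0 'k" and c :: 'k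
  assume x: "Poly_Mapping.keys x \<subseteq> multilinear n"
  show "Poly_Mapping.keys (fscale c x) \<subseteq> multilinear n"
    using x keys_fscale by (rule subset_trans[rotated])
  show "linear_extension (\<lambda>t. basis (relabel id t)) x = x"
    using x by (induction x rule: free_induct) (simp_all add: relabel_ident)
  show "free_comp 1 (basis (Leaf 1)) x = x"
    using x by (induction x rule: free_induct) (simp_all add: graft_unit[unfolded One_nat_def] del: graft.simps)
  show "free_comp i x (basis (Leaf 1)) = x" for i
    using x by (induction x rule: free_induct) (simp_all add: graft_unit'[unfolded One_nat_def])
  show "fscale (- 1) x + x = 0" by simp
  show "Poly_Mapping.keys (linear_extension (\<lambda>t. basis (relabel \<sigma> t)) x) \<subseteq> multilinear n" if "\<sigma> permutes {1..n}" for \<sigma>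
    by (intro keys_linear_extension) (use that x relabel_multilinear[OF that] in auto)
  show "linear_extension (\<lambda>t. basis (relabel \<sigma> t)) (linear_extension (\<lambda>t. basis (relabel \<tau> t)) x) = linear_extension (\<lambda>t. basis (relabel (\<sigma> \<circ> \<tau>) t)) x" for \<sigma> \<tau>
    using x by (induction x rule: free_induct) (simp_all add: comp_def)
  assume y: "Poly_Mapping.keys y \<subseteq> multilinear n"
  show "Poly_Mapping.keys (x + y) \<subseteq> multilinear n"
    using Poly_Mapping.keys_add[of x y] x y by blast
next
  show "Poly_Mapping.keys (basis (Leaf 1)) \<subseteq> multilinear 1" by (simp add: multilinear_def)
qed (simp_all add: algebra_simps free_comp_assoc[unfolded One_nat_def] free_comp_parallel[unfolded One_nat_def] free_comp_equivariant keys_free_comp[simplified])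

lemma block_perm_permutes:
  assumes "1 \<le> i" "i \<le> m" "\<sigma> permutes {1..m}" "\<tau> permutes {1..n}"
  shows "block_perm m i n \<sigma> \<tau> permutes {1..m + n - 1}"
proof (rule inj_imp_permutes)
  have s: "1 \<le> \<sigma> k \<and> \<sigma> k \<le> m" if "1 \<le> k" "k \<le> m" for k
    using permutes_in_image[OF assms(3), of k] that by auto
  have t: "1 \<le> \<tau> k \<and> \<tau> k \<le> n" if "1 \<le> k" "k \<le> n" for k
    using permutes_in_image[OF assms(4), of k] that by auto
  have injs: "\<sigma> a = \<sigma> b \<longleftrightarrow> a = b" for a b using permutes_inj[OF assms(3)] by (auto dest: injD)
  have injt: "\<tau> a = \<tau> b \<longleftrightarrow> a = b" for a b using permutes_inj[OF assms(4)] by (auto dest: injD)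
  define f where "f = block_perm m i n \<sigma> \<tau>"
  define place where "place j = (if j < \<sigma> i then j else j + n - 1)" for j
  have f1: "f k = place (\<sigma> k)" "\<sigma> k \<noteq> \<sigma> i" "1 \<le> \<sigma> k" "\<sigma> k \<le> m" if "1 \<le> k" "k < i" for k
    using that assms(1,2) s[of k] injs[of k i]
    by (auto simp: f_def block_perm_def place_def Let_def)
  have f2: "f k = \<tau> (k + 1 - i) + \<sigma> i - 1" "1 \<le> \<tau> (k + 1 - i)" "\<tau> (k + 1 - i) \<le> n"
    if "i \<le> k" "k < i + n" for k
    using that assms(1,2) t[of "k + 1 - i"] by (auto simp: f_def block_perm_def place_def Let_def)
  have f3: "f k = place (\<sigma> (k + 1 - n))" "\<sigma> (k + 1 - n) \<noteq> \<sigma> i" "1 \<le> \<sigma> (k + 1 - n)" "\<sigma> (k + 1 - n) \<le> m"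
    if "i + n \<le> k" "k \<le> m + n - 1" for k
    using that assms(1,2) s[of "k + 1 - n"] injs[of "k + 1 - n" i]
    by (auto simp: f_def block_perm_def place_def Let_def)
  have si: "1 \<le> \<sigma> i" "\<sigma> i \<le> m" using s[of i] assms by auto
  have pl: "place j \<noteq> p + \<sigma> i - 1" if "j \<noteq> \<sigma> i" "1 \<le> p" "p \<le> n" for j p
    using that si by (auto simp: place_def)
  have pinj: "place j = place j' \<Longrightarrow> j = j'" if "j \<noteq> \<sigma> i" "j' \<noteq> \<sigma> i" for j j'
    using that si by (auto simp: place_def split: if_splits)
  have parts: "(1 \<le> k \<and> k < i) \<or> (i \<le> k \<and> k < i + n) \<or> (i + n \<le> k \<and> k \<le> m + n - 1)"
    if "k \<in> {1..m + n - 1}" for k using that by auto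
  have "inj_on f {1..m + n - 1}"
  proof (rule inj_onI)
    fix a b assume ab: "a \<in> {1..m + n - 1}" "b \<in> {1..m + n - 1}" "f a = f b"
    from parts[OF ab(1)] parts[OF ab(2)] show "a = b"
    proof (elim disjE conjE)
      assume *: "1 \<le> a" "a < i" "1 \<le> b" "b < i"
      show ?thesis using f1[OF *(1,2)] f1[OF *(3,4)] ab(3) pinj injs by metis
    next
      assume *: "1 \<le> a" "a < i" "i \<le> b" "b < i + n"
      show ?thesis using f1[OF *(1,2)] f2[OF *(3,4)] ab(3) pl by metis
    next
      assume *: "1 \<le> a" "a < i" "i + n \<le> b" "b \<le> m + n - 1"
      have "\<sigma> a = \<sigma> (b + 1 - n)" using f1[OF *(1,2)] f3[OF *(3,4)] ab(3) pinj by metis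
      then show ?thesis using * injs by auto
    next
      assume *: "i \<le> a" "a < i + n" "1 \<le> b" "b < i"
      show ?thesis using f1[OF *(3,4)] f2[OF *(1,2)] ab(3) pl by metis
    next
      assume *: "i \<le> a" "a < i + n" "i \<le> b" "b < i + n"
      have "\<tau> (a + 1 - i) = \<tau> (b + 1 - i)" using f2[OF *(1,2)] f2[OF *(3,4)] ab(3) by linarith
      then show ?thesis using * injt by auto
    next
      assume *: "i \<le> a" "a < i + n" "i + n \<le> b" "b \<le> m + n - 1"
      show ?thesis using f3[OF *(3,4)] f2[OF *(1,2)] ab(3) pl by metis
    next
      assume *: "i + n \<le> a" "a \<le> m + n - 1" "1 \<le> b" "b < i"
      have "\<sigma> b = \<sigma> (a + 1 - n)" using f1[OF *(3,4)] f3[OF *(1,2)] ab(3) pinj by metis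
      then show ?thesis using * injs by auto
    next
      assume *: "i + n \<le> a" "a \<le> m + n - 1" "i \<le> b" "b < i + n"
      show ?thesis using f3[OF *(1,2)] f2[OF *(3,4)] ab(3) pl by metis
    next
      assume *: "i + n \<le> a" "a \<le> m + n - 1" "i + n \<le> b" "b \<le> m + n - 1"
      have "\<sigma> (a + 1 - n) = \<sigma> (b + 1 - n)" using f3[OF *(1,2)] f3[OF *(3,4)] ab(3) pinj by metis
      then show ?thesis using * injs by auto
    qed
  qed
  then show "inj_on (block_perm m i n \<sigma> \<tau>) {1..m + n - 1}" by (simp add: f_def)
  have "f a \<in> {1..m + n - 1}" if a: "a \<in> {1..m + n - 1}" for a
    using parts[OF a]
  proof (elim disjE conjE)
    assume "1 \<le> a" "a < i" from f1[OF this] si assms(1,2) show ?thesis by (auto simp: place_def)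
  next
    assume "i \<le> a" "a < i + n" from f2[OF this] si assms(1,2) show ?thesis by auto
  next
    assume "i + n \<le> a" "a \<le> m + n - 1" from f3[OF this] si assms(1,2) show ?thesis by (auto simp: place_def)
  qed
  then show "a \<in> {1..m + n - 1} \<Longrightarrow> block_perm m i n \<sigma> \<tau> a \<in> {1..m + n - 1}" for a by (simp add: f_def)
qed (auto simp: block_perm_def)

context operad
begin

lemma closed_simps [simp]:
  "ozero P n \<in> ocarrier P n"
  "x \<in> ocarrier P n \<Longrightarrow> y \<in> ocarrier P n \<Longrightarrow> oadd P n x y \<in> ocarrier P n"
  "x \<in> ocarrier P n \<Longrightarrow> oscale P n c x \<in> ocarrier P n"
  "\<sigma> permutes {1..n} \<Longrightarrow> x \<in> ocarrier P n \<Longrightarrow> oact P n \<sigma> x \<in> ocarrier P n"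
  "\<lbrakk>1 \<le> i; i \<le> m; x \<in> ocarrier P m; y \<in> ocarrier P n\<rbrakk> \<Longrightarrow> ocomp P m i n x y \<in> ocarrier P (m + n - 1)"
  using zero_closed add_closed scale_closed act_closed comp_closed by blast+

lemma operad_idealD:
  assumes "operad_ideal P I"
  shows "x \<in> I n \<Longrightarrow> x \<in> ocarrier P n" "ozero P n \<in> I n"
    "x \<in> I n \<Longrightarrow> y \<in> I n \<Longrightarrow> oadd P n x y \<in> I n"
    "x \<in> I n \<Longrightarrow> oscale P n c x \<in> I n"
    "x \<in> I n \<Longrightarrow> \<sigma> permutes {1..n} \<Longrightarrow> oact P n \<sigma> x \<in> I n"
    "x \<in> I m \<Longrightarrow> y \<in> ocarrier P n \<Longrightarrow> 1 \<le> i \<Longrightarrow> i \<le> m \<Longrightarrow> ocomp P m i n x y \<in> I (m + n - 1)"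
    "x \<in> ocarrier P m \<Longrightarrow> y \<in> I n \<Longrightarrow> 1 \<le> i \<Longrightarrow> i \<le> m \<Longrightarrow> ocomp P m i n x y \<in> I (m + n - 1)"
  using assms unfolding operad_ideal_def by (simp_all add: subset_iff)

lemma ideal_generated: "operad_ideal P (generated_ideal P S)"
  unfolding operad_ideal_def
proof (intro conjI allI ballI impI subsetI)
  fix n x assume "x \<in> generated_ideal P S n" then show "x \<in> ocarrier P n" by (simp add: generated_ideal_def)
qed (simp_all add: generated_ideal_def operad_idealD del: One_nat_def)

lemma generated_ideal_superset:
  assumes "\<And>n. S n \<subseteq> ocarrier P n"
  shows "S n \<subseteq> generated_ideal P S n"
  using assms by (auto simp: generated_ideal_def)

lemma add_left_commute:
  assumes "x \<in> ocarrier P n" "y \<in> ocarrier P n" "z \<in> ocarrier P n"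
  shows "oadd P n x (oadd P n y z) = oadd P n y (oadd P n x z)"
  by (metis add_assoc add_commute assms)

lemma add_zero_right: "x \<in> ocarrier P n \<Longrightarrow> oadd P n x (ozero P n) = x"
  using add_commute add_zero by simp

end

locale operad_with_ideal = operad +
  fixes I
  assumes ideal: "operad_ideal P I"
begin

lemmas idealD = operad_idealD[OF ideal]

lemma coset_eq:
  assumes "x \<in> ocarrier P n" "u \<in> ocoset P I n x"
  shows "ocoset P I n u = ocoset P I n x" "u \<in> ocarrier P n"
proof -
  from assms obtain i where i: "i \<in> I n" "u = oadd P n x i" by (auto simp: ocoset_def)
  have ic: "i \<in> ocarrier P n" using i idealD by blast
  show u: "u \<in> ocarrier P n" using assms i ic by simp
  have 1: "ocoset P I n u \<subseteq> ocoset P I n x"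
    using i assms ic by (auto simp: ocoset_def add_assoc idealD)
  have "oadd P n x j \<in> ocoset P I n u" if "j \<in> I n" for j
  proof -
    have j: "j \<in> ocarrier P n" using that idealD by blast
    have "oadd P n x j = oadd P n u (oadd P n (oscale P n (- 1) i) j)"
    proof -
      have "oadd P n u (oadd P n (oscale P n (- 1) i) j) = oadd P n x (oadd P n (oadd P n (oscale P n (- 1) i) i) j)"
        using i ic j assms by (simp add: add_assoc add_left_commute)
      also have "\<dots> = oadd P n x j" using ic j by (simp add: add_inverse add_zero)
      finally show ?thesis by simp
    qed
    then show ?thesis unfolding ocoset_def using that i idealD by blast
  qed
  with 1 show "ocoset P I n u = ocoset P I n x" by (auto simp: ocoset_def)
qed

lemma self_coset: "x \<in> ocarrier P n \<Longrightarrow> x \<in> ocoset P I n x"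
  unfolding ocoset_def by (rule image_eqI[of _ _ "ozero P n"]) (simp_all add: idealD add_zero_right)

lemma coset_add: "x \<in> ocarrier P n \<Longrightarrow> i \<in> I n \<Longrightarrow> ocoset P I n (oadd P n x i) = ocoset P I n x"
  by (rule coset_eq) (auto simp: ocoset_def)

lemma UN_const: "x \<in> A \<Longrightarrow> (\<And>y. y \<in> A \<Longrightarrow> f y = c) \<Longrightarrow> (\<Union>y\<in>A. f y) = c"
  by blast

lemma quotient_add: "x \<in> ocarrier P n \<Longrightarrow> y \<in> ocarrier P n \<Longrightarrow>
   oadd (P //\<^sub>o\<^sub>p I) n (ocoset P I n x) (ocoset P I n y) = ocoset P I n (oadd P n x y)"
proof -
  assume x: "x \<in> ocarrier P n" and y: "y \<in> ocarrier P n"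
  have "ocoset P I n (oadd P n u v) = ocoset P I n (oadd P n x y)"
    if "u \<in> ocoset P I n x" "v \<in> ocoset P I n y" for u v
  proof -
    from that obtain i j where *: "i \<in> I n" "u = oadd P n x i" "j \<in> I n" "v = oadd P n y j" by (auto simp: ocoset_def)
    then have c: "i \<in> ocarrier P n" "j \<in> ocarrier P n" using idealD by auto
    have "oadd P n u v = oadd P n (oadd P n x y) (oadd P n i j)"
      using * x y c by (simp add: add_assoc add_left_commute)
    then show ?thesis using coset_add[of "oadd P n x y" n "oadd P n i j"] * x y idealD by simp
  qed
  then have "(\<Union>u\<in>ocoset P I n x. \<Union>v\<in>ocoset P I n y. ocoset P I n (oadd P n u v)) = ocoset P I n (oadd P n x y)"
    by (intro UN_const[OF self_coset[OF x]] UN_const[OF self_coset[OF y]])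
  then show ?thesis by (simp add: quotient_operad_def)
qed

lemma quotient_scale: "x \<in> ocarrier P n \<Longrightarrow>
   oscale (P //\<^sub>o\<^sub>p I) n c (ocoset P I n x) = ocoset P I n (oscale P n c x)"
proof -
  assume x: "x \<in> ocarrier P n"
  have "ocoset P I n (oscale P n c u) = ocoset P I n (oscale P n c x)"
    if "u \<in> ocoset P I n x" for u
    using that x idealD by (auto simp: ocoset_def[of _ _ _ x] scale_add_right coset_add)
  then have "(\<Union>u\<in>ocoset P I n x. ocoset P I n (oscale P n c u)) = ocoset P I n (oscale P n c x)"
    by (intro UN_const[OF self_coset[OF x]])
  then show ?thesis by (simp add: quotient_operad_def)
qed

lemma quotient_act: "x \<in> ocarrier P n \<Longrightarrow> \<sigma> permutes {1..n} \<Longrightarrow>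
   oact (P //\<^sub>o\<^sub>p I) n \<sigma> (ocoset P I n x) = ocoset P I n (oact P n \<sigma> x)"
proof -
  assume x: "x \<in> ocarrier P n" and s: "\<sigma> permutes {1..n}"
  have "ocoset P I n (oact P n \<sigma> u) = ocoset P I n (oact P n \<sigma> x)"
    if "u \<in> ocoset P I n x" for u
    using that x s idealD by (auto simp: ocoset_def[of _ _ _ x] act_add coset_add)
  then have "(\<Union>u\<in>ocoset P I n x. ocoset P I n (oact P n \<sigma> u)) = ocoset P I n (oact P n \<sigma> x)"
    by (intro UN_const[OF self_coset[OF x]])
  then show ?thesis by (simp add: quotient_operad_def)
qed

lemma quotient_comp: "x \<in> ocarrier P m \<Longrightarrow> y \<in> ocarrier P n \<Longrightarrow> 1 \<le> i \<Longrightarrow> i \<le> m \<Longrightarrow>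
   ocomp (P //\<^sub>o\<^sub>p I) m i n (ocoset P I m x) (ocoset P I n y) = ocoset P I (m + n - 1) (ocomp P m i n x y)"
proof -
  assume x: "x \<in> ocarrier P m" and y: "y \<in> ocarrier P n" and i: "1 \<le> i" "i \<le> m"
  have "ocoset P I (m + n - 1) (ocomp P m i n u v) = ocoset P I (m + n - 1) (ocomp P m i n x y)"
    if "u \<in> ocoset P I m x" "v \<in> ocoset P I n y" for u v
  proof -
    from that obtain a b where *: "a \<in> I m" "u = oadd P m x a" "b \<in> I n" "v = oadd P n y b" by (auto simp: ocoset_def)
    then have c: "a \<in> ocarrier P m" "b \<in> ocarrier P n" "v \<in> ocarrier P n" using idealD y by auto
    have "ocomp P m i n u v = oadd P (m + n - 1) (ocomp P m i n x v) (ocomp P m i n a v)"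
      using * x y c i by (simp add: comp_add_left del: One_nat_def)
    then have 1: "ocoset P I (m + n - 1) (ocomp P m i n u v) = ocoset P I (m + n - 1) (ocomp P m i n x v)"
      using coset_add[OF closed_simps(5)[OF i x c(3)] idealD(6)[OF *(1) c(3) i]] by simp
    have "ocomp P m i n x v = oadd P (m + n - 1) (ocomp P m i n x y) (ocomp P m i n x b)"
      using * x y c i by (simp add: comp_add_right del: One_nat_def)
    then show ?thesis
      using 1 coset_add[OF closed_simps(5)[OF i x y] idealD(7)[OF x *(3) i]] by simp
  qed
  then have "(\<Union>u\<in>ocoset P I m x. \<Union>v\<in>ocoset P I n y. ocoset P I (m + n - 1) (ocomp P m i n u v)) = ocoset P I (m + n - 1) (ocomp P m i n x y)"
    by (intro UN_const[OF self_coset[OF x]] UN_const[OF self_coset[OF y]])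
  then show ?thesis by (simp add: quotient_operad_def)
qed

lemma quotient_carrier: "ocarrier (P //\<^sub>o\<^sub>p I) n = ocoset P I n ` ocarrier P n"
  and quotient_zero: "ozero (P //\<^sub>o\<^sub>p I) n = ocoset P I n (ozero P n)"
  and quotient_unit: "ounit (P //\<^sub>o\<^sub>p I) = ocoset P I 1 (ounit P)"
  by (simp_all add: quotient_operad_def)

lemmas quotient_simps = quotient_add quotient_scale quotient_act quotient_comp quotient_zero quotient_unit

lemma arity_arith:
  assumes "1 \<le> i" "i \<le> l" "1 \<le> (j::nat)" "j \<le> m"
  shows "i + j - 1 \<le> l + m - 1" "1 \<le> i + j - 1" "(l + m - 1) + n - 1 = l + (m + n - 1) - 1"
  using assms by auto

lemma operad_quotient: "operad (P //\<^sub>o\<^sub>p I)"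
proof (unfold_locales, unfold quotient_carrier, goal_cases)
  case (5 x n y) then obtain x' y' where "x' \<in> ocarrier P n" "y' \<in> ocarrier P n"
    "x = ocoset P I n x'" "y = ocoset P I n y'" by auto
  then show ?case using add_commute[of x' n y'] by (simp add: quotient_add)
next
  case (12 \<sigma> n x) then show ?case by (auto simp: quotient_simps)
next
  case (18 i m x n y) then show ?case by (auto simp: quotient_simps simp del: One_nat_def)
next
  case (25 i l j m x y z n)
  then obtain x' y' z' where "x' \<in> ocarrier P l" "y' \<in> ocarrier P m" "z' \<in> ocarrier P n"
    "x = ocoset P I l x'" "y = ocoset P I m y'" "z = ocoset P I n z'" by auto
  moreover note 25(1-4) arity_arith[OF 25(1-4)]
  ultimately show ?case by (simp add: quotient_simps comp_assoc del: One_nat_def)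
next
  case (26 i k l x y m z n)
  then obtain x' y' z' where "x' \<in> ocarrier P l" "y' \<in> ocarrier P m" "z' \<in> ocarrier P n"
    "x = ocoset P I l x'" "y = ocoset P I m y'" "z = ocoset P I n z'" by auto
  moreover have "1 \<le> k" "i \<le> l" "k + m - 1 \<le> l + m - 1" "1 \<le> k + m - 1" "1 \<le> i" "i \<le> l + n - 1"
     "l + m - 1 + n - 1 = l + n - 1 + m - 1" using 26(1-3) by auto
  ultimately show ?case using 26(1-3) by (simp add: quotient_simps comp_parallel del: One_nat_def)
next
  case (27 i m \<sigma> \<tau> n x y)
  then obtain x' y' where "x' \<in> ocarrier P m" "y' \<in> ocarrier P n"
    "x = ocoset P I m x'" "y = ocoset P I n y'" by auto
  moreover have "1 \<le> \<sigma> i" "\<sigma> i \<le> m" using 27 permutes_in_image[OF 27(3), of i] by auto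
  moreover have "block_perm m i n \<sigma> \<tau> permutes {1..m+n-1}"
    using 27(1-4) by (rule block_perm_permutes)
  ultimately show ?case using 27(1-4) by (simp add: quotient_simps comp_equivariant del: One_nat_def)
qed (auto simp: quotient_simps add_zero add_inverse scale_add_right scale_add_left scale_scale scale_one
   act_add act_scale act_id act_act unit_closed comp_add_left comp_add_right comp_scale_left comp_scale_right
   unit_comp comp_unit unit_comp[unfolded One_nat_def] comp_unit[unfolded One_nat_def] add_assoc permutes_compose intro: add_commute arg_cong[where f="ocoset P I _"] simp del: One_nat_def)

end


lemma operad_quadratic: "operad (quadratic_operad R)"
proof -
  interpret operad "free_operad :: ('k::field, 'x tree \<Rightarrow>\<^sub>0 'k) operad" by (rule operad_free)
  interpret operad_with_ideal free_operad "quadratic_ideal R"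
    by unfold_locales (simp add: quadratic_ideal_def ideal_generated)
  show ?thesis unfolding quadratic_operad_def by (rule operad_quotient)
qed

lemma operad_As: "operad As" and operad_Alt: "operad Alt" and operad_white_As: "operad (white_As R)"
  by (simp_all add: As_def Alt_def white_As_def operad_quadratic)

lemma operad_white_As_quotient: "operad (white_As_quotient R)"
proof -
  interpret operad "white_As R" by (rule operad_white_As)
  interpret operad_with_ideal "white_As R" "generated_ideal (white_As R) (symmetry_relations R)"
    by unfold_locales (rule ideal_generated)
  show ?thesis unfolding white_As_quotient_def by (rule operad_quotient)
qed

primrec canon :: "'x tree \<Rightarrow> 'x tree" where
  "canon (Leaf j) = Leaf 1"
| "canon (Node a l r) = Node a (canon l) (relabel (\<lambda>p. p + length (leaves l)) (canon r))"

lemma leaves_canon: "leaves (canon t) = [1..<length (leaves t) + 1]"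
proof (induction t)
  case (Node a l r)
  then show ?case
    by (intro nth_equalityI) (auto simp: nth_append simp del: upt_Suc)
qed simp

lemma canon_multilinear: "canon t \<in> multilinear (length (leaves t))"
  by (auto simp: multilinear_def leaves_canon)

lemma canon_graft:
  "canon (Node a l r) = graft 1 (graft 2 (Node a (Leaf 1) (Leaf 2)) (canon r)) (canon l)"
proof -
  have 1: "relabel (\<lambda>p. p + 1 - 1) (canon l) = canon l" by (simp add: relabel_ident)
  have "graft 1 (relabel (\<lambda>p. p + 2 - 1) (canon r)) (canon l) =
    relabel (\<lambda>p. p + length (leaves (canon l)) - 1) (relabel (\<lambda>p. p + 2 - 1) (canon r))"
    by (rule graft_notin') (auto simp: leaves_canon)
  also have "\<dots> = relabel (\<lambda>p. p + length (leaves l)) (canon r)"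
    unfolding relabel_relabel by (rule relabel_cong) (use leaves_nonempty[of l] in \<open>auto simp: leaves_canon Suc_le_eq\<close>)
  finally show ?thesis using 1 by (simp add: relabel_ident)
qed

lemma relabel_canon_aux:
  "(\<And>k. k < length (leaves t) \<Longrightarrow> f (k + 1) = leaves t ! k) \<Longrightarrow> relabel f (canon t) = t"
proof (induction t arbitrary: f)
  case (Leaf j) then show ?case using Leaf[of 0] by simp
next
  case (Node a l r)
  have "relabel f (canon l) = l"
    by (rule Node.IH) (use Node.prems in \<open>auto simp: nth_append\<close>)
  moreover have "relabel (f \<circ> (\<lambda>p. p + length (leaves l))) (canon r) = r"
  proof (rule Node.IH)
    fix k assume "k < length (leaves r)"
    then show "(f \<circ> (\<lambda>p. p + length (leaves l))) (k + 1) = leaves r ! k"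
      using Node.prems[of "k + length (leaves l)"] by (simp add: nth_append)
  qed
  ultimately show ?case by simp
qed

theorem tree_value_hom:
  fixes Q :: "('k::field, 'b) operad"
  assumes hom: "operad_hom free_operad Q \<phi>" and g: "\<And>a. \<phi> 2 (binary a 1 2) = g a"
    and t: "t \<in> multilinear n"
  shows "\<phi> n (basis t) = tree_value Q g t"
proof -
  have hc: "\<phi> (m + n - 1) (free_comp i x y) = ocomp Q m i n (\<phi> m x) (\<phi> n y)"
    if "Poly_Mapping.keys x \<subseteq> multilinear m" "Poly_Mapping.keys y \<subseteq> multilinear n" "1 \<le> i" "i \<le> m" for m n i x y
    using hom that unfolding operad_hom_def free_operad_simps by simp
  have planar: "\<phi> (length (leaves t)) (basis (canon t)) = planar_value Q g t" for t
  proof (induction t)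
    case (Leaf j)
    then show ?case using hom by (simp add: operad_hom_def free_operad_simps)
  next
    case (Node a l r)
    define p where "p = length (leaves l)"
    define q where "q = length (leaves r)"
    have p: "1 \<le> p" "1 \<le> q" using leaves_nonempty[of l] leaves_nonempty[of r] by (auto simp: p_def q_def Suc_le_eq)
    have l: "canon l \<in> multilinear p" and r: "canon r \<in> multilinear q"
      using canon_multilinear by (auto simp: p_def q_def)
    have b: "Node a (Leaf 1) (Leaf 2) \<in> multilinear 2" by (auto simp: multilinear_def)
    have gr: "graft 2 (Node a (Leaf 1) (Leaf 2)) (canon r) \<in> multilinear (q + 1)"
      using graft_multilinear[OF b r, of 2] by simp
    have "\<phi> (2 + q - 1) (free_comp 2 (basis (Node a (Leaf 1) (Leaf 2))) (basis (canon r))) = ocomp Q 2 2 q (g a) (planar_value Q g r)"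
      using hc[of "basis (Node a (Leaf 1) (Leaf 2))" 2 "basis (canon r)" q 2] b r Node g[of a]
      by (simp add: binary_def q_def)
    then have 1: "\<phi> (q + 1) (basis (graft 2 (Node a (Leaf 1) (Leaf 2)) (canon r))) = ocomp Q 2 2 q (g a) (planar_value Q g r)"
      by (simp del: graft.simps)
    have "\<phi> (q + 1 + p - 1) (free_comp 1 (basis (graft 2 (Node a (Leaf 1) (Leaf 2)) (canon r))) (basis (canon l)))
      = ocomp Q (q + 1) 1 p (ocomp Q 2 2 q (g a) (planar_value Q g r)) (planar_value Q g l)"
      using hc[of "basis (graft 2 (Node a (Leaf 1) (Leaf 2)) (canon r))" "q + 1" "basis (canon l)" p 1] gr l Node 1
      by (simp add: p_def del: graft.simps)
    then show ?case
      unfolding canon_graft by (simp add: p_def q_def Let_def add.commute del: graft.simps)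
  qed
  define \<sigma> where "\<sigma> = (\<lambda>k. if 1 \<le> k \<and> k \<le> n then leaves t ! (k - 1) else k)"
  have n: "length (leaves t) = n" using length_leaves t by blast
  have d: "distinct (leaves t)" "set (leaves t) = {1..n}" using t by (auto simp: multilinear_def)
  have perm: "\<sigma> permutes {1..n}"
  proof (rule inj_imp_permutes)
    show "inj_on \<sigma> {1..n}"
    proof (rule inj_onI)
      fix x y assume "x \<in> {1..n}" "y \<in> {1..n}" "\<sigma> x = \<sigma> y"
      moreover from this have "x - 1 < length (leaves t)" "y - 1 < length (leaves t)" using n by auto
      ultimately show "x = y" using nth_eq_iff_index_eq[OF d(1), of "x - 1" "y - 1"] by (auto simp: \<sigma>_def)
    qed
    show "\<sigma> x \<in> {1..n}" if "x \<in> {1..n}" for x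
    proof -
      have "leaves t ! (x - 1) \<in> set (leaves t)" using that n by (intro nth_mem) auto
      then show ?thesis using that d by (auto simp: \<sigma>_def)
    qed
  qed (auto simp: \<sigma>_def)
  have "relabel \<sigma> (canon t) = t" by (rule relabel_canon_aux) (simp add: \<sigma>_def n)
  then have "basis t = oact free_operad n \<sigma> (basis (canon t) :: _ \<Rightarrow>\<^sub>0 'k)" by (simp add: free_operad_simps)
  moreover have "\<phi> n (oact free_operad n \<sigma> (basis (canon t))) = oact Q n \<sigma> (\<phi> n (basis (canon t)))"
  proof -
    have "basis (canon t) \<in> ocarrier free_operad n"
      using canon_multilinear[of t] n by (simp add: free_operad_simps)
    then show ?thesis using hom perm unfolding operad_hom_def by blast
  qed
  ultimately have "\<phi> n (basis t) = oact Q n \<sigma> (planar_value Q g t)" using planar[of t] n by simp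
  then show ?thesis by (simp add: tree_value_def n \<sigma>_def Let_def)
qed

end

theory Submission
  imports Defs
begin

text \<open>
  Setting \<open>y \<succ> x = x \<prec> y = xy\<close> in the white product leaves only the flexible law
  \<open>(x, y, z) + (z, y, x) = 0\<close>. An isomorphism with \<open>Alt\<close> would therefore yield scalars \<open>a, b\<close>, not
  both zero, such that \<open>x * y = a xy + b yx\<close> is alternative in every flexible algebra. The algebras
  spanned by magmas that are associative or commutative are flexible. For the left zero band
  \<open>xy = x\<close> the first alternative law gives \<open>ab = 0\<close>, and for the two-element magma
  \<open>xy = \<not> (x \<and> y)\<close> the second gives \<open>(a + b)\<^sup>2 = 0\<close>; hence \<open>a = b = 0\<close>. This works in every
  characteristic.
\<close>

text \<open>Why flexibility: fix the word xyz of As(3). A monomial in \<prec> and \<succ> with this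
  planar word has x or z as its outer leaf, so its Alt component is one of eight of the twelve
  monomials. In Alt(3) the six associators agree up to sign, and only those of (x, y, z) and (z, y,
  x) have both terms among the eight. So a single relation per word survives.

  The quotient itself is never computed. It is enough that every relation of the white product holds
  in every flexible magma, and for this a linear map on Alt(3) that extends evaluation on the eight
  monomials suffices.

  Two test magmas appear because the isomorphism may send any combination of xy and yx to the
  generator of Alt: a noncommutative magma detects the product of the two scalars, a commutative one
  their sum. In both, the variables are assigned so that the coefficient read off carries no factor
  2.\<close>

lemma linear_extension_uminus [simp]: "linear_extension g (- f) = - linear_extension g f"
proof -
  have "- f = fscale (- 1) f" for f :: "'z \<Rightarrow>\<^sub>0 'k::field" by simp
  then show ?thesis by (metis linear_extension_fscale)
qed

lemma linear_extension_diff [simp]: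
  "linear_extension g (f - f') = linear_extension g f - linear_extension g f'"
  using linear_extension_add[of g f "- f'"] by simp

lemma linear_extension_cong:
  "(\<And>b. b \<in> Poly_Mapping.keys f \<Longrightarrow> g b = h b) \<Longrightarrow> linear_extension g f = linear_extension h f"
  by (simp add: linear_extension_def)

lemma linear_extension_compose:
  "linear_extension g (linear_extension h f) = linear_extension (\<lambda>b. linear_extension g (h b)) f"
proof -
  have "Poly_Mapping.keys f \<subseteq> UNIV" by simp
  then show ?thesis by (induction f rule: free_induct) simp_all
qed

section \<open>Trees with at most three leaves\<close>

lemma multilinear_0: "multilinear 0 = {}"
  using leaves_nonempty by (auto simp: multilinear_def)

lemma free_carrier_0: "ocarrier free_operad 0 = {0}"
  by (auto simp: free_operad_simps multilinear_0)

lemma leaves_singleton: "leaves t = [j] \<longleftrightarrow> t = Leaf j"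
  by (cases t) (auto simp: append_eq_Cons_conv leaves_nonempty)

lemma leaves_pair: "leaves t = [i, j] \<longleftrightarrow> (\<exists>a. t = Node a (Leaf i) (Leaf j))"
  by (cases t) (auto simp: append_eq_Cons_conv leaves_nonempty leaves_singleton)

lemma leaves_triple:
  "leaves t = [i, j, k] \<longleftrightarrow>
    (\<exists>a b. t = Node a (Node b (Leaf i) (Leaf j)) (Leaf k) \<or> t = Node a (Leaf i) (Node b (Leaf j) (Leaf k)))"
  by (cases t) (auto simp: append_eq_Cons_conv leaves_nonempty leaves_singleton leaves_pair)

lemma multilinear_1: "multilinear (Suc 0) = {Leaf 1}"
proof -
  have "leaves t = [1]" if "t \<in> multilinear (Suc 0)" for t :: "'x tree"
  proof -
    have "length (leaves t) = Suc 0" using that by (rule length_leaves)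
    then obtain j where "leaves t = [j]" by (auto simp: length_Suc_conv)
    then show ?thesis using that by (auto simp: multilinear_def)
  qed
  then show ?thesis by (auto simp: leaves_singleton multilinear_def)
qed

lemma multilinear_2D:
  assumes "t \<in> multilinear 2"
  obtains a where "t = Node a (Leaf 1) (Leaf 2)" | a where "t = Node a (Leaf 2) (Leaf 1)"
proof -
  have "length (leaves t) = Suc (Suc 0)" using length_leaves[OF assms] by simp
  then obtain i j where ij: "leaves t = [i, j]" by (auto simp: length_Suc_conv)
  have "set [i, j] = {1..2}" using assms unfolding multilinear_def mem_Collect_eq ij by blast
  moreover have "{1..2::nat} = {1, 2}" by auto
  ultimately have "{i, j} = {1, 2}" by simp
  then have "i = 1 \<and> j = 2 \<or> i = 2 \<and> j = 1" by (simp add: doubleton_eq_iff)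
  moreover obtain a where "t = Node a (Leaf i) (Leaf j)" using ij leaves_pair[of t i j] by blast
  ultimately show thesis using that by metis
qed

lemma multilinear_3D:
  assumes "t \<in> multilinear 3"
  obtains a b i j k where "{i, j, k} = {1, 2, 3}" "i \<noteq> j" "i \<noteq> k" "j \<noteq> k"
    "t = Node a (Node b (Leaf i) (Leaf j)) (Leaf k) \<or> t = Node a (Leaf i) (Node b (Leaf j) (Leaf k))"
proof -
  have "length (leaves t) = Suc (Suc (Suc 0))" using length_leaves[OF assms] by simp
  then obtain i j k where ijk: "leaves t = [i, j, k]" by (auto simp: length_Suc_conv)
  have "set [i, j, k] = {1..3}" "distinct [i, j, k]"
    using assms unfolding multilinear_def mem_Collect_eq ijk by blast+
  moreover have "{1..3::nat} = {1, 2, 3}" by auto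
  ultimately have "{i, j, k} = {1, 2, 3}" "i \<noteq> j" "i \<noteq> k" "j \<noteq> k"
    by simp_all
  moreover obtain a b where
    "t = Node a (Node b (Leaf i) (Leaf j)) (Leaf k) \<or> t = Node a (Leaf i) (Node b (Leaf j) (Leaf k))"
    using ijk leaves_triple[of t i j k] by blast
  ultimately show thesis by (rule that)
qed


subsection \<open>Quotients and homomorphisms\<close>

context operad_with_ideal
begin

lemma coset_eq_zero_iff:
  assumes "x \<in> ocarrier P n"
  shows "ocoset P I n x = ocoset P I n (ozero P n) \<longleftrightarrow> x \<in> I n"
proof
  assume "ocoset P I n x = ocoset P I n (ozero P n)"
  then have "x \<in> ocoset P I n (ozero P n)" using self_coset[OF assms] by simp
  then show "x \<in> I n" using idealD by (auto simp: ocoset_def add_zero)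
next
  assume "x \<in> I n"
  then show "ocoset P I n x = ocoset P I n (ozero P n)"
    using coset_add[of "ozero P n" n x] assms by (simp add: add_zero)
qed

lemma projection_hom: "operad_hom P (P //\<^sub>o\<^sub>p I) (ocoset P I)"
  unfolding operad_hom_def
  by (auto simp: quotient_simps quotient_carrier simp del: One_nat_def)

lemma ideal_image:
  assumes "operad_ideal P J"
  shows "operad_ideal (P //\<^sub>o\<^sub>p I) (\<lambda>n. ocoset P I n ` J n)"
proof -
  note J = operad_idealD[OF assms]
  show ?thesis
    unfolding operad_ideal_def quotient_carrier
    using J by (auto simp: quotient_simps image_iff simp del: One_nat_def)
qed

text \<open>Since \<open>J\<close> contains \<open>I\<close>, it is a union of cosets of
  \<open>I\<close>, so membership in \<open>J\<close> can be tested in the quotient.\<close>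

lemma coset_in_image:
  assumes "operad_ideal P J" "\<And>n. I n \<subseteq> J n" "x \<in> ocarrier P n" "ocoset P I n x \<in> ocoset P I n ` J n"
  shows "x \<in> J n"
proof -
  note J = operad_idealD[OF assms(1)]
  obtain y where "y \<in> J n" "ocoset P I n x = ocoset P I n y" using assms(4) by blast
  then have "x \<in> ocoset P I n y" using self_coset[OF assms(3)] by simp
  then show ?thesis using \<open>y \<in> J n\<close> assms(2)[of n] J(3) by (auto simp: ocoset_def)
qed

end

lemma operad_hom_comp:
  assumes "operad_hom P Q \<phi>" "operad_hom Q T \<psi>"
  shows "operad_hom P T (\<lambda>n x. \<psi> n (\<phi> n x))"
  using assms unfolding operad_hom_def by simp

lemma operad_homD:
  assumes "operad_hom P Q \<phi>"
  shows "x \<in> ocarrier P n \<Longrightarrow> \<phi> n x \<in> ocarrier Q n"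
    "x \<in> ocarrier P n \<Longrightarrow> y \<in> ocarrier P n \<Longrightarrow> \<phi> n (oadd P n x y) = oadd Q n (\<phi> n x) (\<phi> n y)"
    "x \<in> ocarrier P n \<Longrightarrow> \<phi> n (oscale P n c x) = oscale Q n c (\<phi> n x)"
    "x \<in> ocarrier P n \<Longrightarrow> \<sigma> permutes {1..n} \<Longrightarrow> \<phi> n (oact P n \<sigma> x) = oact Q n \<sigma> (\<phi> n x)"
    "x \<in> ocarrier P m \<Longrightarrow> y \<in> ocarrier P n \<Longrightarrow> 1 \<le> i \<Longrightarrow> i \<le> m \<Longrightarrow>
      \<phi> (m + n - 1) (ocomp P m i n x y) = ocomp Q m i n (\<phi> m x) (\<phi> n y)"
  using assms unfolding operad_hom_def by simp_all

interpretation free: operad free_operad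
  by (rule operad_free)

lemma quadratic_ideal: "operad_ideal free_operad (quadratic_ideal R)"
  unfolding quadratic_ideal_def by (rule free.ideal_generated)

interpretation quadratic: operad_with_ideal free_operad "quadratic_ideal R" for R
  unfolding operad_with_ideal_def operad_with_ideal_axioms_def
  by (simp add: operad_free quadratic_ideal)

lemma quadratic_ideal_least:
  assumes "operad_ideal free_operad J" "R \<subseteq> J 3"
  shows "quadratic_ideal R n \<subseteq> J n"
  using assms unfolding quadratic_ideal_def generated_ideal_def by auto

text \<open>The quotient of the free operad by everything of arity above three sees only the
  \<open>S\<^sub>3\<close>-submodule that the relations span.\<close>

lemma quadratic_ideal_low_arity:
  fixes R :: "('x tree \<Rightarrow>\<^sub>0 'k::field) set"
  assumes sub: "N \<subseteq> ocarrier free_operad 3" and zero: "0 \<in> N"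
    and add: "\<And>f g. f \<in> N \<Longrightarrow> g \<in> N \<Longrightarrow> f + g \<in> N"
    and scale: "\<And>c f. f \<in> N \<Longrightarrow> fscale c f \<in> N"
    and act: "\<And>\<sigma> f. f \<in> N \<Longrightarrow> \<sigma> permutes {1..3} \<Longrightarrow> oact free_operad 3 \<sigma> f \<in> N"
    and R: "R \<subseteq> N"
  shows "quadratic_ideal R 3 \<subseteq> N" "quadratic_ideal R 2 \<subseteq> {0}"
proof -
  \<comment> \<open>Nothing below arity 3 and everything above it: closure under composition becomes
    a question about arity 3 alone.\<close>
  define J where "J n = (if n < 3 then {0} else if n = 3 then N else ocarrier free_operad n)" for n :: nat
  have Jc: "x \<in> ocarrier free_operad n" if "x \<in> J n" for x n
    using that sub by (auto simp: J_def free_operad_simps split: if_splits)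
  have unary: "\<exists>c. x = fscale c (basis (Leaf 1))" if "x \<in> ocarrier free_operad 1" for x :: "'x tree \<Rightarrow>\<^sub>0 'k"
  proof -
    have "Poly_Mapping.keys x \<subseteq> {Leaf 1}" using that by (simp add: free_operad_simps multilinear_1)
    then show ?thesis
      by (intro exI[of _ "Poly_Mapping.lookup x (Leaf 1)"] poly_mapping_eqI)
        (auto simp: lookup_single when_def in_keys_iff)
  qed
  have comp: "free_comp i x y \<in> J (m + n - 1)"
    if x: "x \<in> ocarrier free_operad m" and y: "y \<in> ocarrier free_operad n" and i: "1 \<le> i" "i \<le> m"
      and J: "x \<in> J m \<or> y \<in> J n" for m n i and x y :: "'x tree \<Rightarrow>\<^sub>0 'k"
  proof -
    have c: "free_comp i x y \<in> ocarrier free_operad (m + n - 1)"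
      using keys_free_comp x y i by (fastforce simp: free_operad_simps)
    consider "x = 0 \<or> y = 0" | "m + n - 1 > 3" | "m + n - 1 \<le> 3" "x \<noteq> 0" "y \<noteq> 0" by linarith
    then show ?thesis
    proof cases
      case 1
      then show ?thesis using zero by (auto simp: J_def free_operad_simps)
    next
      case 2
      then show ?thesis using c by (auto simp: J_def)
    next
      case 3
      \<comment> \<open>Only an argument of arity 0 could lower the arity, and the free operad is
        zero there. So if a nonzero element of \<open>J\<close> takes part and the result has arity
        at most 3, the other factor is unary, hence a multiple of the unit.\<close>
      have n: "n \<noteq> 0" using 3 y free_carrier_0 by (metis singletonD)
      have "3 \<le> m \<or> 3 \<le> n" using J 3 by (auto simp: J_def split: if_splits)
      then consider "m = 3" "n = 1" | "m = 1" "n = 3" using 3(1) n i by linarith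
      then show ?thesis
      proof cases
        case 1
        then obtain c where "y = fscale c (basis (Leaf 1))" using unary y by blast
        then have "free_comp i x y = fscale c x"
          using free.comp_unit[of i m x] x i by (simp add: free_operad_simps)
        moreover have "x \<in> N" using J 1 3 by (auto simp: J_def)
        ultimately show ?thesis using 1 scale by (simp add: J_def)
      next
        case 2
        then obtain c where "x = fscale c (basis (Leaf 1))" using unary x by blast
        moreover have "i = 1" using 2 i by simp
        ultimately have "free_comp i x y = fscale c y"
          using free.unit_comp[of y n] y by (simp add: free_operad_simps)
        moreover have "y \<in> N" using J 2 3 by (auto simp: J_def)
        ultimately show ?thesis using 2 scale by (simp add: J_def)
      qed
    qed
  qed
  have "operad_ideal free_operad J"
    unfolding operad_ideal_def
  proof (intro conjI allI ballI impI subsetI)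
    fix n and x y :: "'x tree \<Rightarrow>\<^sub>0 'k" assume "x \<in> J n" "y \<in> J n"
    then show "oadd free_operad n x y \<in> J n"
      using add free.add_closed[of x n y] by (auto simp: J_def free_operad_simps(3) split: if_splits)
  next
    fix n c and x :: "'x tree \<Rightarrow>\<^sub>0 'k" assume "x \<in> J n"
    then show "oscale free_operad n c x \<in> J n"
      using scale free.scale_closed[of x n c] by (auto simp: J_def free_operad_simps(4) split: if_splits)
  next
    fix n \<sigma> and x :: "'x tree \<Rightarrow>\<^sub>0 'k" assume "x \<in> J n" "\<sigma> permutes {1..n}"
    then show "oact free_operad n \<sigma> x \<in> J n"
      using act free.act_closed[of \<sigma> n x] by (auto simp: J_def free_operad_simps(5) split: if_splits)
  next
    fix m n i and x y :: "'x tree \<Rightarrow>\<^sub>0 'k"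
    assume "x \<in> J m" "y \<in> ocarrier free_operad n" "1 \<le> i \<and> i \<le> m"
    then show "ocomp free_operad m i n x y \<in> J (m + n - 1)"
      using comp Jc by (simp add: free_operad_simps(7))
  next
    fix m n i and x y :: "'x tree \<Rightarrow>\<^sub>0 'k"
    assume "x \<in> ocarrier free_operad m" "y \<in> J n" "1 \<le> i \<and> i \<le> m"
    then show "ocomp free_operad m i n x y \<in> J (m + n - 1)"
      using comp Jc by (simp add: free_operad_simps(7))
  next
    show "x \<in> ocarrier free_operad n" if "x \<in> J n" for n x using Jc that .
    show "ozero free_operad n \<in> J n" for n using zero by (simp add: J_def free_operad_simps)
  qed
  moreover have "R \<subseteq> J 3" using R by (simp add: J_def)
  ultimately have "quadratic_ideal R n \<subseteq> J n" for n by (rule quadratic_ideal_least)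
  from this[of 3] this[of 2] show "quadratic_ideal R 3 \<subseteq> N" "quadratic_ideal R 2 \<subseteq> {0}"
    by (auto simp: J_def)
qed


subsection \<open>Identities of a magma\<close>

primrec eval_tree :: "('x \<Rightarrow> 'a \<Rightarrow> 'a \<Rightarrow> 'a) \<Rightarrow> (nat \<Rightarrow> 'a) \<Rightarrow> 'x tree \<Rightarrow> 'a" where
  "eval_tree m \<rho> (Leaf j) = \<rho> j"
| "eval_tree m \<rho> (Node a l r) = m a (eval_tree m \<rho> l) (eval_tree m \<rho> r)"

lemma eval_tree_relabel: "eval_tree m \<rho> (relabel f t) = eval_tree m (\<rho> \<circ> f) t"
  by (induction t) auto

lemma eval_tree_graft:
  "eval_tree m \<rho> (graft i t s) =
    eval_tree m (\<lambda>j. if j < i then \<rho> j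
      else if j = i then eval_tree m (\<lambda>p. \<rho> (p + i - 1)) s
      else \<rho> (j + length (leaves s) - 1)) t"
  by (induction t) (auto simp: eval_tree_relabel comp_def)

text \<open>Variables range over magma elements, which are the basis vectors of the magma algebra.
  For multilinear polynomials this already tests an identity on the whole algebra.\<close>

definition evaluation ::
    "('x \<Rightarrow> 'a \<Rightarrow> 'a \<Rightarrow> 'a) \<Rightarrow> (nat \<Rightarrow> 'a) \<Rightarrow> ('x tree \<Rightarrow>\<^sub>0 'k::field) \<Rightarrow> ('a \<Rightarrow>\<^sub>0 'k)" where
  "evaluation m \<rho> = linear_extension (\<lambda>t. basis (eval_tree m \<rho> t))"

definition identities ::
    "('x \<Rightarrow> 'a \<Rightarrow> 'a \<Rightarrow> 'a) \<Rightarrow> nat \<Rightarrow> ('x tree \<Rightarrow>\<^sub>0 'k::field) set" where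
  "identities m n = {f \<in> ocarrier free_operad n. \<forall>\<rho>. evaluation m \<rho> f = 0}"

lemma evaluation_simps [simp]:
  "evaluation m \<rho> 0 = 0"
  "evaluation m \<rho> (f + g) = evaluation m \<rho> f + evaluation m \<rho> g"
  "evaluation m \<rho> (f - g) = evaluation m \<rho> f - evaluation m \<rho> g"
  "evaluation m \<rho> (fscale c f) = fscale c (evaluation m \<rho> f)"
  "evaluation m \<rho> (basis t) = basis (eval_tree m \<rho> t)"
  by (simp_all add: evaluation_def)

lemma evaluation_act:
  "evaluation m \<rho> (oact free_operad n \<sigma> f) = evaluation m (\<rho> \<circ> \<sigma>) f"
  by (simp add: evaluation_def free_operad_simps linear_extension_compose eval_tree_relabel)

text \<open>Substituting a monomial for a variable amounts to evaluating \<open>f\<close> at another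
  assignment.\<close>

lemma evaluation_comp_left:
  fixes f g :: "'x tree \<Rightarrow>\<^sub>0 'k::field"
  assumes "\<And>\<rho>. evaluation m \<rho> f = 0" "Poly_Mapping.keys g \<subseteq> multilinear n"
  shows "evaluation m \<rho> (free_comp i f g) = 0"
  using assms(2)
proof (induction g rule: free_induct)
  case (basis s)
  let ?\<rho> = "\<lambda>j. if j < i then \<rho> j else if j = i then eval_tree m (\<lambda>p. \<rho> (p + i - 1)) s
    else \<rho> (j + length (leaves s) - 1)"
  have "evaluation m \<rho> (free_comp i f (basis s)) = evaluation m ?\<rho> f"
    by (simp add: evaluation_def free_comp_def linear_extension_compose eval_tree_graft del: One_nat_def)
  then show ?case using assms(1) by simp
qed simp_all

text \<open>With a monomial outside, the composite depends on an inner monomial only through its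
  value, by a map \<open>h\<close> of the magma. Extended linearly, \<open>h\<close> sends the value
  0 of \<open>g\<close> to 0. A fixed arity of \<open>g\<close> matters, because the shift of the
  later variables is read off from the number of leaves.\<close>

lemma evaluation_comp_right:
  fixes f g :: "'x tree \<Rightarrow>\<^sub>0 'k::field"
  assumes "\<And>\<rho>. evaluation m \<rho> g = 0" "Poly_Mapping.keys g \<subseteq> multilinear n"
    "Poly_Mapping.keys f \<subseteq> multilinear l"
  shows "evaluation m \<rho> (free_comp i f g) = 0"
  using assms(3)
proof (induction f rule: free_induct)
  case (basis t)
  define h where
    "h v = eval_tree m (\<lambda>j. if j < i then \<rho> j else if j = i then v else \<rho> (j + n - 1)) t" for v
  have "evaluation m \<rho> (free_comp i (basis t) g)
      = linear_extension (\<lambda>s. basis (eval_tree m \<rho> (graft i t s))) g"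
    by (simp add: evaluation_def free_comp_def linear_extension_compose)
  also have "\<dots> = linear_extension (\<lambda>s. basis (h (eval_tree m (\<lambda>p. \<rho> (p + i - 1)) s))) g"
  proof (rule linear_extension_cong)
    fix s assume "s \<in> Poly_Mapping.keys g"
    then have "length (leaves s) = n" using assms(2) length_leaves by blast
    then show "basis (eval_tree m \<rho> (graft i t s)) = basis (h (eval_tree m (\<lambda>p. \<rho> (p + i - 1)) s))"
      by (simp add: h_def eval_tree_graft cong: if_cong)
  qed
  also have "\<dots> = linear_extension (\<lambda>v. basis (h v)) (evaluation m (\<lambda>p. \<rho> (p + i - 1)) g)"
    by (simp add: evaluation_def linear_extension_compose)
  finally show ?case using assms(1) by simp
qed simp_all

lemma ideal_identities:
  fixes m :: "'x \<Rightarrow> 'a \<Rightarrow> 'a \<Rightarrow> 'a"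
  shows "operad_ideal (free_operad :: ('k::field, 'x tree \<Rightarrow>\<^sub>0 'k) operad) (identities m)"
proof -
  show ?thesis
    unfolding operad_ideal_def
  proof (intro conjI allI ballI impI subsetI)
    fix l n i and f g :: "'x tree \<Rightarrow>\<^sub>0 'k"
    assume "f \<in> identities m l" "g \<in> ocarrier free_operad n" "1 \<le> i \<and> i \<le> l"
    then show "ocomp free_operad l i n f g \<in> identities m (l + n - 1)"
      using free.comp_closed[of i l f g n] evaluation_comp_left[of m f g n]
      by (simp add: identities_def free_operad_simps)
  next
    fix l n i and f g :: "'x tree \<Rightarrow>\<^sub>0 'k"
    assume "f \<in> ocarrier free_operad l" "g \<in> identities m n" "1 \<le> i \<and> i \<le> l"
    then show "ocomp free_operad l i n f g \<in> identities m (l + n - 1)"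
      using free.comp_closed[of i l f g n] evaluation_comp_right[of m g n f l]
      by (simp add: identities_def free_operad_simps)
  next
    fix n and f g :: "'x tree \<Rightarrow>\<^sub>0 'k"
    assume "f \<in> identities m n" "g \<in> identities m n"
    then show "oadd free_operad n f g \<in> identities m n"
      using free.add_closed[of f n g] by (simp add: identities_def free_operad_simps)
  next
    fix n c and f :: "'x tree \<Rightarrow>\<^sub>0 'k"
    assume "f \<in> identities m n"
    then show "oscale free_operad n c f \<in> identities m n"
      using free.scale_closed[of f n c] by (simp add: identities_def free_operad_simps)
  next
    fix n \<sigma> and f :: "'x tree \<Rightarrow>\<^sub>0 'k"
    assume "f \<in> identities m n" "\<sigma> permutes {1..n}"
    then show "oact free_operad n \<sigma> f \<in> identities m n"
      using free.act_closed[of \<sigma> n f] by (simp add: identities_def evaluation_act)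
  qed (simp_all add: identities_def free_operad_simps)
qed


subsection \<open>The two components of the natural map\<close>

text \<open>For \<open>s\<close> empty this gives the factor in \<open>As\<close>, for \<open>s\<close> selecting \<open>\<succ>\<close> the other factor.\<close>

primrec flip_tree :: "('x \<Rightarrow> bool) \<Rightarrow> 'x tree \<Rightarrow> unit tree" where
  "flip_tree s (Leaf j) = Leaf j"
| "flip_tree s (Node a l r) =
    (if s a then Node () (flip_tree s r) (flip_tree s l) else Node () (flip_tree s l) (flip_tree s r))"

lemma set_leaves_flip [simp]: "set (leaves (flip_tree s t)) = set (leaves t)"
  by (induction t) auto

lemma length_leaves_flip [simp]: "length (leaves (flip_tree s t)) = length (leaves t)"
  by (induction t) auto

lemma distinct_leaves_flip [simp]: "distinct (leaves (flip_tree s t)) = distinct (leaves t)"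
  by (induction t) auto

lemma flip_multilinear: "t \<in> multilinear n \<Longrightarrow> flip_tree s t \<in> multilinear n"
  by (simp add: multilinear_def)

lemma flip_relabel: "flip_tree s (relabel f t) = relabel f (flip_tree s t)"
  by (induction t) auto

lemma flip_graft: "flip_tree s (graft i t u) = graft i (flip_tree s t) (flip_tree s u)"
  by (induction t) (auto simp: flip_relabel)

lemma flip_hom:
  "operad_hom (free_operad :: ('k::field, 'x tree \<Rightarrow>\<^sub>0 'k) operad) free_operad
    (\<lambda>n. linear_extension (\<lambda>t. basis (flip_tree s t)))"
proof -
  let ?\<phi> = "linear_extension (\<lambda>t. basis (flip_tree s t)) :: ('x tree \<Rightarrow>\<^sub>0 'k) \<Rightarrow> _"
  have comp: "?\<phi> (free_comp i f g) = free_comp i (?\<phi> f) (?\<phi> g)" for i f g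
  proof -
    have "Poly_Mapping.keys f \<subseteq> UNIV" "Poly_Mapping.keys g \<subseteq> UNIV" by auto
    then show ?thesis
    proof (induction f rule: free_induct)
      case (basis t)
      from basis(2) show ?case by (induction g rule: free_induct) (simp_all add: flip_graft)
    qed simp_all
  qed
  have "Poly_Mapping.keys (?\<phi> f) \<subseteq> multilinear n" if "Poly_Mapping.keys f \<subseteq> multilinear n" for f n
    using that flip_multilinear by (intro keys_linear_extension) auto
  then show ?thesis
    unfolding operad_hom_def free_operad_simps
    by (auto simp: comp linear_extension_compose flip_relabel)
qed

lemma quadratic_class_hom: "operad_hom free_operad (quadratic_operad R) (quadratic_class R)"
  using quadratic.projection_hom by (simp add: quadratic_operad_def quadratic_class_def[abs_def])

text \<open>Flipping is a morphism of free operads. Followed by the projection it sends every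
  generator where \<open>g\<close> does, and a morphism out of a free operad is determined by that.
  The recursive value thus becomes the class of an explicit monomial.\<close>

lemma tree_value_flip:
  assumes "t \<in> multilinear n"
    and "\<And>a. g a = quadratic_class R 2 (basis (flip_tree s (Node a (Leaf 1) (Leaf 2))))"
  shows "tree_value (quadratic_operad R) g t = quadratic_class R n (basis (flip_tree s t))"
  using tree_value_hom[OF operad_hom_comp[OF flip_hom[where s = s] quadratic_class_hom[of R]] _ assms(1), of g] assms(2)
  by (simp add: binary_def)

lemma tree_value_As:
  assumes "t \<in> multilinear n"
  shows "tree_value As As_part t =
    quadratic_class associative_relations n (basis (flip_tree (\<lambda>_. False) t))"
  unfolding As_def using assms by (rule tree_value_flip) (simp add: As_part_def binary_def)

lemma tree_value_second:
  assumes "t \<in> multilinear n"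
  shows "tree_value (quadratic_operad R) (second_part R) t =
    quadratic_class R n (basis (flip_tree (\<lambda>a. a = Succ) t))"
  using assms
proof (rule tree_value_flip)
  show "second_part R a = quadratic_class R 2 (basis (flip_tree (\<lambda>a. a = Succ) (Node a (Leaf 1) (Leaf 2))))" for a
    by (cases a) (simp_all add: binary_def)
qed

text \<open>Half of the universal property of the tensor product: it allows the kernel of the
  natural map to be tested by a bilinear map, without bases of As(3) and Alt(3).\<close>

lemma tensor_relations_vanish:
  fixes B :: "'a \<Rightarrow> 'b \<Rightarrow> ('c \<Rightarrow>\<^sub>0 'k::field)"
  assumes "\<And>x x' y. x \<in> ocarrier P n \<Longrightarrow> x' \<in> ocarrier P n \<Longrightarrow> y \<in> ocarrier Q n \<Longrightarrow>
      B (oadd P n x x') y = B x y + B x' y"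
    and "\<And>x y y'. x \<in> ocarrier P n \<Longrightarrow> y \<in> ocarrier Q n \<Longrightarrow> y' \<in> ocarrier Q n \<Longrightarrow>
      B x (oadd Q n y y') = B x y + B x y'"
    and "\<And>c x y. x \<in> ocarrier P n \<Longrightarrow> y \<in> ocarrier Q n \<Longrightarrow> B (oscale P n c x) y = fscale c (B x y)"
    and "\<And>c x y. x \<in> ocarrier P n \<Longrightarrow> y \<in> ocarrier Q n \<Longrightarrow> B x (oscale Q n c y) = fscale c (B x y)"
    and "z \<in> tensor_relations P Q n"
  shows "linear_extension (\<lambda>(x, y). B x y) z = 0"
  using assms(5) unfolding tensor_relations_def
proof (induction z rule: free_space.span_induct_alt)
  case (step c x y)
  then show ?case using assms(1-4) by auto
qed simp



subsection \<open>Relations of the white product\<close>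

lemma free_diff_closed:
  "f \<in> ocarrier free_operad n \<Longrightarrow> g \<in> ocarrier free_operad n \<Longrightarrow> f - g \<in> ocarrier free_operad n"
  using free.add_closed[of f n "fscale (- 1) g"] free.scale_closed[of g n "- 1"]
  by (simp add: free_operad_simps)

lemmas free_closed = free.add_closed[unfolded free_operad_simps(3)]
  free.scale_closed[unfolded free_operad_simps(4)] free_diff_closed

lemma associator_closed:
  assumes "distinct [i, j, k]" "{i, j, k} = {1..3}"
  shows "associator i j k \<in> ocarrier free_operad 3"
proof -
  have "Node () (Node () (Leaf i) (Leaf j)) (Leaf k) \<in> multilinear 3"
    "Node () (Leaf i) (Node () (Leaf j) (Leaf k)) \<in> multilinear 3"
    using assms by (simp_all add: multilinear_def)
  then show ?thesis
    unfolding associator_def by (intro free_diff_closed) (simp_all add: free_operad_simps)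
qed

lemma atLeastAtMost_1_3: "{Suc 0..3} = {1, 2, 3}"
  by auto

lemma alternative_relations_closed: "alternative_relations \<subseteq> ocarrier free_operad 3"
  using free.add_closed[OF associator_closed associator_closed, of 1 2 3 2 1 3]
    free.add_closed[OF associator_closed associator_closed, of 1 2 3 1 3 2]
  by (auto simp: alternative_relations_def free_operad_simps(3) atLeastAtMost_1_3)

lemma distinct_triple_cases:
  assumes "distinct [x, y, z]" "{x, y, z} = {1, 2, 3::nat}"
  shows "x = 1 \<and> y = 2 \<and> z = 3 \<or> x = 1 \<and> y = 3 \<and> z = 2 \<or> x = 2 \<and> y = 1 \<and> z = 3 \<or>
    x = 2 \<and> y = 3 \<and> z = 1 \<or> x = 3 \<and> y = 1 \<and> z = 2 \<or> x = 3 \<and> y = 2 \<and> z = 1"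
proof -
  have "x \<in> {1, 2, 3}" "y \<in> {1, 2, 3}" "z \<in> {1, 2, 3}" using assms(2) by blast+
  then show ?thesis using assms(1) by auto
qed

lemma class_representative:
  assumes "f \<in> ocarrier free_operad n"
  shows "\<exists>p \<in> quadratic_ideal R n. (SOME f'. f' \<in> quadratic_class R n f) = f + p"
proof -
  have "f \<in> quadratic_class R n f"
    unfolding quadratic_class_def using assms by (rule quadratic.self_coset)
  then have "(SOME f'. f' \<in> quadratic_class R n f) \<in> quadratic_class R n f" by (rule someI)
  then show ?thesis by (auto simp: quadratic_class_def ocoset_def free_operad_simps)
qed

section \<open>Linear maps that vanish on the cubic relations of As and Alt\<close>

lemma associative_ideal_leaves:
  fixes f :: "unit tree \<Rightarrow>\<^sub>0 'k::field" and h :: "nat list \<Rightarrow> ('b \<Rightarrow>\<^sub>0 'k)"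
  assumes "f \<in> quadratic_ideal associative_relations 3"
  shows "linear_extension (\<lambda>s. h (leaves s)) f = 0"
proof -
  \<comment> \<open>The two bracketings have the same leaf word, so every \<open>h\<close> kills the
    associator. Quantifying over all \<open>h\<close> makes \<open>N\<close> stable under
    permutations: relabelling replaces \<open>h\<close> by
    \<open>h \<circ> map \<sigma>\<close>.\<close>
  define N :: "(unit tree \<Rightarrow>\<^sub>0 'k) set" where
    "N = {f \<in> ocarrier free_operad 3. \<forall>h :: nat list \<Rightarrow> ('b \<Rightarrow>\<^sub>0 'k). linear_extension (\<lambda>s. h (leaves s)) f = 0}"
  have "quadratic_ideal associative_relations 3 \<subseteq> N"
  proof (rule quadratic_ideal_low_arity(1))
    fix \<sigma> :: "nat \<Rightarrow> nat" and f assume f: "f \<in> N" and \<sigma>: "\<sigma> permutes {1..3}"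
    have "linear_extension (\<lambda>s. h (leaves s)) (oact free_operad 3 \<sigma> f)
        = linear_extension (\<lambda>s. h (map \<sigma> (leaves s))) f" for h :: "nat list \<Rightarrow> ('b \<Rightarrow>\<^sub>0 'k)"
      by (simp add: free_operad_simps linear_extension_compose)
    moreover have "linear_extension (\<lambda>s. h (map \<sigma> (leaves s))) f = 0" for h :: "nat list \<Rightarrow> ('b \<Rightarrow>\<^sub>0 'k)"
      using f unfolding N_def by (auto dest: spec[of _ "h \<circ> map \<sigma>"])
    moreover have "oact free_operad 3 \<sigma> f \<in> ocarrier free_operad 3"
      using f \<sigma> by (intro free.act_closed) (simp_all add: N_def)
    ultimately show "oact free_operad 3 \<sigma> f \<in> N" by (simp add: N_def)
  next
    have "associator 1 2 3 \<in> ocarrier (free_operad :: ('k, unit tree \<Rightarrow>\<^sub>0 'k) operad) 3"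
      by (rule associator_closed) (auto simp: atLeastAtMost_1_3)
    then show "associative_relations \<subseteq> N" by (simp add: associative_relations_def N_def associator_def)
  next
    fix f g assume "f \<in> N" "g \<in> N"
    then show "f + g \<in> N" using free.add_closed[of f 3 g] by (simp add: N_def free_operad_simps)
  next
    fix c f assume "f \<in> N"
    then show "fscale c f \<in> N" using free.scale_closed[of f 3 c] by (simp add: N_def free_operad_simps)
  qed (auto simp: N_def free_operad_simps)
  then show ?thesis using assms by (auto simp: N_def)
qed

text \<open>
  Of the twelve monomials in \<open>Alt(3)\<close> only the eight whose outer leaf is not \<open>x\<^sub>y\<close> occur together
  with the word \<open>x\<^sub>x x\<^sub>y x\<^sub>z\<close> of \<open>As(3)\<close>. The values of the other four are free, and they are
  chosen so that every associator takes the value of \<open>(x\<^sub>x, x\<^sub>y, x\<^sub>z)\<close> up to the sign of the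
  permutation.
\<close>

fun twisted_value ::
    "('a \<Rightarrow> 'a \<Rightarrow> 'a) \<Rightarrow> (nat \<Rightarrow> 'a) \<Rightarrow> nat \<Rightarrow> nat \<Rightarrow> nat \<Rightarrow> unit tree \<Rightarrow> ('a \<Rightarrow>\<^sub>0 'k::field)" where
  "twisted_value c \<rho> x y z (Node _ (Node _ (Leaf i) (Leaf j)) (Leaf k)) =
    (let d = basis (c (c (\<rho> x) (\<rho> y)) (\<rho> z)) - basis (c (\<rho> x) (c (\<rho> y) (\<rho> z))) in
     if k = y then basis (c (\<rho> i) (c (\<rho> j) (\<rho> k))) + (if i = x then - d else d)
     else basis (c (c (\<rho> i) (\<rho> j)) (\<rho> k)))"
| "twisted_value c \<rho> x y z (Node _ (Leaf i) (Node _ (Leaf j) (Leaf k))) =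
    (let d = basis (c (c (\<rho> x) (\<rho> y)) (\<rho> z)) - basis (c (\<rho> x) (c (\<rho> y) (\<rho> z))) in
     if i = y then basis (c (c (\<rho> i) (\<rho> j)) (\<rho> k)) + (if j = x then d else - d)
     else basis (c (\<rho> i) (c (\<rho> j) (\<rho> k))))"

text \<open>Injectivity preserves the tests such as \<open>k = y\<close>; having three leaves keeps
  the tree within the patterns of \<open>twisted_value\<close>.\<close>

lemma twisted_value_relabel:
  assumes "inj \<sigma>" "t \<in> multilinear 3"
  shows "twisted_value c \<rho> (\<sigma> x) (\<sigma> y) (\<sigma> z) (relabel \<sigma> t) = twisted_value c (\<rho> \<circ> \<sigma>) x y z t"
  using assms(2) by (rule multilinear_3D) (auto simp: Let_def inj_eq[OF assms(1)])

text \<open>The vanishing of \<open>(u, v, w) + (w, v, u)\<close> with all signs made positive. The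
  terms of the two sums agree in order for associative magmas and crosswise for commutative ones.
  The scalars occur only inside the equation, hence the type argument.\<close>

definition flexible :: "('k::field) itself \<Rightarrow> ('a \<Rightarrow> 'a \<Rightarrow> 'a) \<Rightarrow> bool" where
  "flexible _ c \<longleftrightarrow> (\<forall>u v w. (basis (c (c u v) w) + basis (c (c w v) u) :: 'a \<Rightarrow>\<^sub>0 'k)
    = basis (c u (c v w)) + basis (c w (c v u)))"

text \<open>Four of the values come from the choice of the twisted monomials, and (x, y, z) gives
  the definition of \<open>d\<close>. Both monomials of (z, y, x) have plain values, so this is the
  one place where flexibility enters.\<close>

lemma twisted_value_associator:
  fixes c :: "'a \<Rightarrow> 'a \<Rightarrow> 'a" and \<rho> :: "nat \<Rightarrow> 'a"
  assumes "flexible TYPE('k::field) c" and xyz: "distinct [x, y, z]"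
  defines "d \<equiv> basis (c (c (\<rho> x) (\<rho> y)) (\<rho> z)) - basis (c (\<rho> x) (c (\<rho> y) (\<rho> z))) :: 'a \<Rightarrow>\<^sub>0 'k"
    and "L \<equiv> linear_extension (twisted_value c \<rho> x y z)"
  shows "L (associator x y z) = d" "L (associator y z x) = d" "L (associator z x y) = d"
    "L (associator y x z) = - d" "L (associator x z y) = - d" "L (associator z y x) = - d"
proof -
  have "basis (c (c (\<rho> z) (\<rho> y)) (\<rho> x)) - basis (c (\<rho> z) (c (\<rho> y) (\<rho> x))) = - d"
    using assms(1) by (simp add: flexible_def d_def algebra_simps)
  then show "L (associator z y x) = - d" using xyz by (simp add: L_def associator_def)
qed (use xyz in \<open>simp_all add: L_def d_def associator_def\<close>)

lemma alternative_ideal_twisted_value: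
  fixes c :: "'a \<Rightarrow> 'a \<Rightarrow> 'a" and f :: "unit tree \<Rightarrow>\<^sub>0 'k::field"
  assumes flex: "flexible TYPE('k) c"
    and f: "f \<in> quadratic_ideal alternative_relations 3" and xyz: "distinct [x, y, z]" "{x, y, z} = {1, 2, 3}"
  shows "linear_extension (twisted_value c \<rho> x y z) f = 0"
proof -
  define N :: "(unit tree \<Rightarrow>\<^sub>0 'k) set" where
    "N = {f \<in> ocarrier free_operad 3. \<forall>\<rho> x y z. distinct [x, y, z] \<and> {x, y, z} = {1, 2, 3} \<longrightarrow>
      linear_extension (twisted_value c \<rho> x y z) f = 0}"
  have "quadratic_ideal alternative_relations 3 \<subseteq> N"
  proof (rule quadratic_ideal_low_arity(1))
    fix \<sigma> :: "nat \<Rightarrow> nat" and f assume f: "f \<in> N" and \<sigma>: "\<sigma> permutes {1..3}"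
    have inj: "inj \<sigma>" using \<sigma> by (rule permutes_inj)
    have "linear_extension (twisted_value c \<rho> x y z) (oact free_operad 3 \<sigma> f) = 0"
      if xyz: "distinct [x, y, z]" "{x, y, z} = {1, 2, 3}" for \<rho> x y z
    proof -
      \<comment> \<open>Pulling the word back along \<sigma> moves the permutation into the
        assignment; this is why \<open>N\<close> ranges over all orderings and all
        assignments.\<close>
      obtain x' y' z' where x': "x = \<sigma> x'" "y = \<sigma> y'" "z = \<sigma> z'"
        using permutes_surj[OF \<sigma>] by (metis surjD)
      have "\<sigma> ` {x', y', z'} = \<sigma> ` {1, 2, 3}"
        using permutes_image[OF \<sigma>] xyz x' by (simp add: atLeastAtMost_1_3)
      then have "{x', y', z'} = {1, 2, 3}" by (simp only: inj_image_eq_iff[OF inj])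
      moreover have "distinct [x', y', z']" using xyz(1) x' by auto
      ultimately have "linear_extension (twisted_value c (\<rho> \<circ> \<sigma>) x' y' z') f = 0" using f by (simp add: N_def)
      moreover have "linear_extension (twisted_value c \<rho> x y z) (oact free_operad 3 \<sigma> f)
          = linear_extension (twisted_value c (\<rho> \<circ> \<sigma>) x' y' z') f"
        unfolding free_operad_simps linear_extension_compose linear_extension_basis x'
      proof (rule linear_extension_cong)
        fix t assume "t \<in> Poly_Mapping.keys f"
        then have "t \<in> multilinear 3" using f by (auto simp: N_def free_operad_simps)
        with inj show "twisted_value c \<rho> (\<sigma> x') (\<sigma> y') (\<sigma> z') (relabel \<sigma> t)
            = twisted_value c (\<rho> \<circ> \<sigma>) x' y' z' t"
          by (rule twisted_value_relabel)
      qed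
      ultimately show ?thesis by simp
    qed
    moreover have "oact free_operad 3 \<sigma> f \<in> ocarrier free_operad 3"
      using f \<sigma> by (intro free.act_closed) (simp_all add: N_def)
    ultimately show "oact free_operad 3 \<sigma> f \<in> N" by (simp add: N_def)
  next
    have "linear_extension (twisted_value c \<rho> x y z) r = 0"
      if "distinct [x, y, z]" "{x, y, z} = {1, 2, 3}" "r \<in> alternative_relations" for \<rho> x y z and r :: "unit tree \<Rightarrow>\<^sub>0 'k"
    proof -
      have "x = 1 \<and> y = 2 \<and> z = 3 \<or> x = 1 \<and> y = 3 \<and> z = 2 \<or> x = 2 \<and> y = 1 \<and> z = 3 \<or>
        x = 2 \<and> y = 3 \<and> z = 1 \<or> x = 3 \<and> y = 1 \<and> z = 2 \<or> x = 3 \<and> y = 2 \<and> z = 1"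
        using that(1,2) by (rule distinct_triple_cases)
      moreover have "r = associator 1 2 3 + associator 2 1 3 \<or> r = associator 1 2 3 + associator 1 3 2"
        using that(3) by (simp add: alternative_relations_def)
      \<comment> \<open>Each relator adds two associators whose arguments differ by a transposition,
        so for every ordering their values are \<open>d\<close> and \<open>- d\<close>.\<close>
      moreover note twisted_value_associator[OF flex that(1), of \<rho>]
      ultimately show ?thesis by (elim disjE conjE) (simp_all only: linear_extension_add, simp_all)
    qed
    moreover have "alternative_relations \<subseteq> ocarrier (free_operad :: ('k, unit tree \<Rightarrow>\<^sub>0 'k) operad) 3"
      by (rule alternative_relations_closed)
    ultimately show "alternative_relations \<subseteq> N" by (auto simp: N_def)
  next
    fix f g assume "f \<in> N" "g \<in> N"
    then show "f + g \<in> N" using free.add_closed[of f 3 g] by (simp add: N_def free_operad_simps)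
  next
    fix c f assume "f \<in> N"
    then show "fscale c f \<in> N" using free.scale_closed[of f 3 c] by (simp add: N_def free_operad_simps)
  qed (auto simp: N_def free_operad_simps)
  from subsetD[OF this f] xyz show ?thesis by (simp add: N_def)
qed

section \<open>The bilinear form on As(3) and Alt(3), and the relations of the white product\<close>

primrec manin_operation :: "('a \<Rightarrow> 'a \<Rightarrow> 'a) \<Rightarrow> manin_label \<Rightarrow> 'a \<Rightarrow> 'a \<Rightarrow> 'a" where
  "manin_operation c Prec u v = c u v"
| "manin_operation c Succ u v = c v u"

text \<open>The form is written on representatives. The first argument enters only through the leaf
  words of its monomials, and each word selects the linear map applied to the second
  argument.\<close>

definition As_twisted ::
    "('a \<Rightarrow> 'a \<Rightarrow> 'a) \<Rightarrow> (nat \<Rightarrow> 'a) \<Rightarrow> (unit tree \<Rightarrow>\<^sub>0 'k::field) \<Rightarrow> (unit tree \<Rightarrow>\<^sub>0 'k) \<Rightarrow> ('a \<Rightarrow>\<^sub>0 'k)" where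
  "As_twisted c \<rho> f g = linear_extension (\<lambda>s.
     linear_extension (twisted_value c \<rho> (leaves s ! 0) (leaves s ! 1) (leaves s ! 2)) g) f"

lemma As_twisted_simps [simp]:
  "As_twisted c \<rho> (f + f') g = As_twisted c \<rho> f g + As_twisted c \<rho> f' g"
  "As_twisted c \<rho> f (g + g') = As_twisted c \<rho> f g + As_twisted c \<rho> f g'"
  "As_twisted c \<rho> (fscale a f) g = fscale a (As_twisted c \<rho> f g)"
  "As_twisted c \<rho> f (fscale a g) = fscale a (As_twisted c \<rho> f g)"
  by (simp_all add: As_twisted_def linear_extension_fun_add linear_extension_fun_scale)

text \<open>The outer leaf of \<open>t\<close> is the first or the last letter of its word, and
  flipping keeps it outer. The middle letter is never outer, so only plain values occur.\<close>

lemma As_twisted_flip: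
  assumes "t \<in> multilinear 3"
  shows "As_twisted c \<rho> (basis (flip_tree (\<lambda>_. False) t)) (basis (flip_tree (\<lambda>a. a = Succ) t))
    = basis (eval_tree (manin_operation c) \<rho> t)"
proof (cases rule: multilinear_3D[OF assms])
  case (1 a b i j k)
  then show ?thesis
    by (cases a; cases b) (auto simp: As_twisted_def numeral_2_eq_2)
qed

lemma As_twisted_left_zero:
  assumes "f \<in> quadratic_ideal associative_relations 3"
  shows "As_twisted c \<rho> f g = 0"
  using associative_ideal_leaves[OF assms, of "\<lambda>w. linear_extension (twisted_value c \<rho> (w ! 0) (w ! 1) (w ! 2)) g"]
  by (simp add: As_twisted_def)

lemma As_twisted_right_zero:
  assumes "flexible TYPE('k::field) c" "f \<in> ocarrier free_operad 3"
    and "g \<in> quadratic_ideal alternative_relations 3"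
  shows "As_twisted c \<rho> f (g :: unit tree \<Rightarrow>\<^sub>0 'k) = 0"
proof -
  have "linear_extension (twisted_value c \<rho> (leaves s ! 0) (leaves s ! 1) (leaves s ! 2)) g = 0"
    if "s \<in> multilinear 3" for s :: "unit tree"
    using that
  proof (cases rule: multilinear_3D)
    case (1 a b i j k)
    then show ?thesis
      using alternative_ideal_twisted_value[OF assms(1,3), of i j k \<rho>] by (auto simp: numeral_2_eq_2)
  qed
  then have "As_twisted c \<rho> f g = linear_extension (\<lambda>_. 0) f"
    unfolding As_twisted_def by (intro linear_extension_cong) (use assms(2) in \<open>auto simp: free_operad_simps\<close>)
  then show ?thesis by (simp add: linear_extension_def)
qed

text \<open>Evaluation in a flexible magma factors through the natural map to the tensor product of
  As(3) and Alt(3), hence kills its kernel.\<close>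

lemma white_relations_identities:
  fixes c :: "'a \<Rightarrow> 'a \<Rightarrow> 'a"
  assumes flex: "flexible TYPE('k::field) c"
  shows "(white_relations alternative_relations :: (manin_label tree \<Rightarrow>\<^sub>0 'k) set)
    \<subseteq> identities (manin_operation c) 3"
proof
  fix f :: "manin_label tree \<Rightarrow>\<^sub>0 'k" assume f: "f \<in> white_relations alternative_relations"
  let ?As = "As :: ('k, (unit tree \<Rightarrow>\<^sub>0 'k) set) operad"
  let ?Alt = "quadratic_operad alternative_relations :: ('k, (unit tree \<Rightarrow>\<^sub>0 'k) set) operad"
  let ?a = "quadratic_class associative_relations 3 :: _ \<Rightarrow> (unit tree \<Rightarrow>\<^sub>0 'k) set"
  let ?b = "quadratic_class alternative_relations 3 :: _ \<Rightarrow> (unit tree \<Rightarrow>\<^sub>0 'k) set"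
  let ?F = "ocarrier (free_operad :: ('k, unit tree \<Rightarrow>\<^sub>0 'k) operad) 3"
  define z where "z = linear_extension (\<lambda>t. basis (tree_value ?As As_part t,
    tree_value ?Alt (second_part alternative_relations) t)) f"
  have fc: "f \<in> ocarrier free_operad 3" using f by (simp add: white_relations_def)
  have z: "z \<in> tensor_relations ?As ?Alt 3"
  proof -
    have "0 \<in> tensor_relations ?As ?Alt 3"
      unfolding tensor_relations_def by (rule free_space.span_zero)
    moreover have "(+) z ` tensor_relations ?As ?Alt 3 = (+) 0 ` tensor_relations ?As ?Alt 3"
      using f by (simp add: white_relations_def white_natural_map_def tensor_class_def z_def)
    ultimately show ?thesis by (metis (no_types, lifting) add.right_neutral add_0 image_iff)
  qed
  have "evaluation (manin_operation c) \<rho> f = 0" for \<rho>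
  proof -
    \<comment> \<open>\<open>SOME\<close> picks representatives of the two cosets. The choice has no
      effect, since \<open>As_twisted\<close> vanishes when either argument lies in its
      ideal.\<close>
    define B where "B A U = As_twisted c \<rho> (SOME f. f \<in> A) (SOME g. g \<in> U)"
      for A U :: "(unit tree \<Rightarrow>\<^sub>0 'k) set"
    have B: "B (?a f) (?b g) = As_twisted c \<rho> f g" if fg: "f \<in> ?F" "g \<in> ?F" for f g
    proof -
      obtain p where "p \<in> quadratic_ideal associative_relations 3" "(SOME f'. f' \<in> ?a f) = f + p"
        using class_representative[OF fg(1)] by blast
      moreover obtain q where "q \<in> quadratic_ideal alternative_relations 3" "(SOME g'. g' \<in> ?b g) = g + q"
        using class_representative[OF fg(2)] by blast
      ultimately show ?thesis
        by (simp add: B_def As_twisted_left_zero As_twisted_right_zero[OF flex fg(1)])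
    qed
    have carrier: "\<exists>f \<in> ?F. A = quadratic_class R 3 f" if "A \<in> ocarrier (quadratic_operad R) 3" for A R
      using that by (auto simp: quadratic_operad_def quadratic_class_def quadratic.quotient_carrier)
    note hom = operad_homD(2,3)[OF quadratic_class_hom, unfolded free_operad_simps(3,4), symmetric]
    have "linear_extension (\<lambda>(A, U). B A U) z = 0"
    proof (rule tensor_relations_vanish[OF _ _ _ _ z])
      fix A A' U assume "A \<in> ocarrier ?As 3" "A' \<in> ocarrier ?As 3" "U \<in> ocarrier ?Alt 3"
      then obtain f f' g where "A = ?a f" "A' = ?a f'" "U = ?b g" "f \<in> ?F" "f' \<in> ?F" "g \<in> ?F"
        unfolding As_def by (meson carrier)
      then show "B (oadd ?As 3 A A') U = B A U + B A' U"
        using free.add_closed[of f 3 f'] by (simp add: As_def hom B free_operad_simps(3))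
    next
      fix A U U' assume "A \<in> ocarrier ?As 3" "U \<in> ocarrier ?Alt 3" "U' \<in> ocarrier ?Alt 3"
      then obtain f g g' where "A = ?a f" "U = ?b g" "U' = ?b g'" "f \<in> ?F" "g \<in> ?F" "g' \<in> ?F"
        unfolding As_def by (meson carrier)
      then show "B A (oadd ?Alt 3 U U') = B A U + B A U'"
        using free.add_closed[of g 3 g'] by (simp add: hom B free_operad_simps(3))
    next
      fix a A U assume "A \<in> ocarrier ?As 3" "U \<in> ocarrier ?Alt 3"
      then obtain f g where "A = ?a f" "U = ?b g" "f \<in> ?F" "g \<in> ?F"
        unfolding As_def by (meson carrier)
      then show "B (oscale ?As 3 a A) U = fscale a (B A U)" "B A (oscale ?Alt 3 a U) = fscale a (B A U)"
        using free.scale_closed[of f 3 a] free.scale_closed[of g 3 a]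
        by (simp_all add: As_def hom B free_operad_simps(4))
    qed
    moreover have "linear_extension (\<lambda>(A, U). B A U) z = evaluation (manin_operation c) \<rho> f"
      unfolding z_def evaluation_def linear_extension_compose linear_extension_basis
    proof (rule linear_extension_cong)
      fix t assume "t \<in> Poly_Mapping.keys f"
      then have t: "t \<in> multilinear 3" using fc by (auto simp: free_operad_simps)
      then have "basis (flip_tree s t) \<in> ?F" for s by (simp add: free_operad_simps flip_multilinear)
      then show "(case (tree_value ?As As_part t, tree_value ?Alt (second_part alternative_relations) t) of
          (A, U) \<Rightarrow> B A U) = basis (eval_tree (manin_operation c) \<rho> t)"
        using As_twisted_flip[OF t] by (simp add: tree_value_As[OF t] tree_value_second[OF t] B)
    qed
    ultimately show ?thesis by simp
  qed
  then show "f \<in> identities (manin_operation c) 3" using fc by (simp add: identities_def)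
qed



subsection \<open>The quotient of the white product\<close>

interpretation white: operad_with_ideal "white_As R" "generated_ideal (white_As R) (symmetry_relations R)" for R
  unfolding operad_with_ideal_def operad_with_ideal_axioms_def
  by (simp add: operad_white_As operad.ideal_generated)

definition white_projection ::
    "(unit tree \<Rightarrow>\<^sub>0 'k::field) set \<Rightarrow> nat \<Rightarrow> (manin_label tree \<Rightarrow>\<^sub>0 'k) \<Rightarrow> (manin_label tree \<Rightarrow>\<^sub>0 'k) set set" where
  "white_projection R n f =
    ocoset (white_As R) (generated_ideal (white_As R) (symmetry_relations R)) n
      (quadratic_class (white_relations R) n f)"

lemma white_class_hom: "operad_hom free_operad (white_As R) (quadratic_class (white_relations R))"
  unfolding white_As_def by (rule quadratic_class_hom)

lemma white_projection_hom: "operad_hom free_operad (white_As_quotient R) (white_projection R)"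
  using operad_hom_comp[OF white_class_hom white.projection_hom[of R]]
  by (simp add: white_As_quotient_def white_projection_def[abs_def])

lemma white_projection_carrier:
  "ocarrier (white_As_quotient R) n = white_projection R n ` ocarrier free_operad n"
proof -
  have "ocarrier (white_As R) n = quadratic_class (white_relations R) n ` ocarrier free_operad n"
    by (simp add: white_As_def quadratic_operad_def quadratic_class_def quadratic.quotient_carrier)
  then show ?thesis
    by (simp add: white_As_quotient_def white_projection_def[abs_def] white.quotient_carrier image_image)
qed

lemma white_projection_add:
  "f \<in> ocarrier free_operad n \<Longrightarrow> g \<in> ocarrier free_operad n \<Longrightarrow>
    white_projection R n (f + g) = oadd (white_As_quotient R) n (white_projection R n f) (white_projection R n g)"
  using operad_homD(2)[OF white_projection_hom] by (simp add: free_operad_simps)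

lemma white_projection_scale:
  "f \<in> ocarrier free_operad n \<Longrightarrow>
    white_projection R n (fscale a f) = oscale (white_As_quotient R) n a (white_projection R n f)"
  using operad_homD(3)[OF white_projection_hom] by (simp add: free_operad_simps)

lemma white_projection_eq_iff:
  assumes f: "f \<in> ocarrier free_operad n" and g: "g \<in> ocarrier free_operad n"
  shows "white_projection R n f = white_projection R n g \<longleftrightarrow>
    quadratic_class (white_relations R) n (f - g) \<in> generated_ideal (white_As R) (symmetry_relations R) n"
proof -
  have d: "f - g \<in> ocarrier free_operad n" using f g by (rule free_diff_closed)
  have "white_projection R n (f - g) = white_projection R n 0"
    if "white_projection R n f = white_projection R n g"
  proof -
    have "white_projection R n (f + fscale (- 1) g) = white_projection R n (g + fscale (- 1) g)"
      using f g free.scale_closed[of g n "- 1"] that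
      by (simp only: white_projection_add free_operad_simps(4))
    then show ?thesis by simp
  qed
  moreover have "white_projection R n f = white_projection R n g"
    if "white_projection R n (f - g) = white_projection R n 0"
  proof -
    have "white_projection R n ((f - g) + g) = white_projection R n (0 + g)"
      using white_projection_add[OF d g, of R] white_projection_add[OF free.zero_closed g, of R] that
      by (simp add: free_operad_simps(2))
    then show ?thesis by simp
  qed
  moreover have "white_projection R n (f - g) = white_projection R n 0 \<longleftrightarrow>
    quadratic_class (white_relations R) n (f - g) \<in> generated_ideal (white_As R) (symmetry_relations R) n"
  proof -
    have "quadratic_class (white_relations R) n 0 = ozero (white_As R) n"
      by (simp add: white_As_def quadratic_operad_def quadratic_class_def quadratic.quotient_zero free_operad_simps)
    then show ?thesis
      using white.coset_eq_zero_iff[of "quadratic_class (white_relations R) n (f - g)" R n]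
        operad_homD(1)[OF white_class_hom d] by (simp add: white_projection_def)
  qed
  ultimately show ?thesis by blast
qed

text \<open>The image of \<open>J\<close> in the white product is an ideal containing the symmetry
  relations, and \<open>J\<close> contains the kernel of the first projection. With \<open>J\<close>
  the identities of a flexible magma, this bounds the kernel of the double quotient from
  above.\<close>

lemma white_projection_kernel:
  assumes J: "operad_ideal free_operad J" "white_relations R \<subseteq> J 3"
    "binary Succ 1 2 - binary Prec 2 1 \<in> J 2" "binary Succ 2 1 - binary Prec 1 2 \<in> J 2"
    and f: "f \<in> ocarrier free_operad n" and g: "g \<in> ocarrier free_operad n"
    and eq: "white_projection R n f = white_projection R n g"
  shows "f - g \<in> J n"
proof -
  let ?J = "\<lambda>n. quadratic_class (white_relations R) n ` J n"
  have "operad_ideal (white_As R) ?J"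
    using quadratic.ideal_image[OF J(1), of "white_relations R"]
    by (simp add: white_As_def quadratic_operad_def quadratic_class_def)
  moreover have "symmetry_relations R k \<subseteq> ?J k" for k
    using J(3,4) by (simp add: symmetry_relations_def)
  moreover have "quadratic_class (white_relations R) n (f - g)
      \<in> generated_ideal (white_As R) (symmetry_relations R) n"
    using white_projection_eq_iff[OF f g] eq by simp
  ultimately have "quadratic_class (white_relations R) n (f - g) \<in> ?J n"
    unfolding generated_ideal_def by blast
  then show ?thesis
    using quadratic.coset_in_image[OF J(1) quadratic_ideal_least[OF J(1,2)] free_diff_closed[OF f g]]
    by (simp add: quadratic_class_def)
qed

lemma binary_closed: "{i, j} = {1, 2} \<Longrightarrow> binary a i j \<in> ocarrier free_operad 2"
  by (auto simp: free_operad_simps binary_def multilinear_def doubleton_eq_iff)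

lemma white_projection_symmetry:
  "white_projection R 2 (binary Succ 1 2) = white_projection R 2 (binary Prec 2 1)"
  "white_projection R 2 (binary Succ 2 1) = white_projection R 2 (binary Prec 1 2)"
proof -
  note c = binary_closed[OF refl] binary_closed[OF insert_commute]
  have "symmetry_relations R n \<subseteq> ocarrier (white_As R) n" for n
    by (simp add: symmetry_relations_def operad_homD(1)[OF white_class_hom] free_diff_closed c del: One_nat_def)
  then have "symmetry_relations R 2 \<subseteq> generated_ideal (white_As R) (symmetry_relations R) 2"
    by (rule white.generated_ideal_superset)
  then show "white_projection R 2 (binary Succ 1 2) = white_projection R 2 (binary Prec 2 1)"
    "white_projection R 2 (binary Succ 2 1) = white_projection R 2 (binary Prec 1 2)"
    by (simp_all add: white_projection_eq_iff symmetry_relations_def c del: One_nat_def)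
qed

lemma generator_combination_closed:
  "fscale a (binary l 1 2) + fscale b (binary l 2 1) \<in> ocarrier free_operad 2"
  by (intro free_closed binary_closed) auto

text \<open>The symmetry relations turn each \<succ> into a \<prec> with exchanged arguments. This
  is the source of the two scalars.\<close>

lemma white_projection_arity_2:
  fixes f :: "manin_label tree \<Rightarrow>\<^sub>0 'k::field"
  assumes "f \<in> ocarrier free_operad 2"
  shows "\<exists>a b. white_projection R 2 f =
    white_projection R 2 (fscale a (binary Prec 1 2) + fscale b (binary Prec 2 1))"
proof -
  let ?e = "\<lambda>a b :: 'k. fscale a (binary Prec 1 2) + fscale b (binary Prec 2 1)"
  have c: "?e a b \<in> ocarrier free_operad 2" for a b
    by (rule generator_combination_closed)
  have "Poly_Mapping.keys f \<subseteq> multilinear 2" using assms by (simp add: free_operad_simps)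
  then show ?thesis
  proof (induction f rule: free_induct)
    case zero
    have "0 = ?e 0 0" by simp
    then show ?case by metis
  next
    case (basis t)
    have "?e 1 0 = binary Prec 1 2" "?e 0 1 = binary Prec 2 1" by simp_all
    moreover have "basis t = binary Prec 1 2 \<or> basis t = binary Prec 2 1 \<or>
        basis t = binary Succ 1 2 \<or> basis t = binary Succ 2 1"
    proof (cases rule: multilinear_2D[OF basis])
      case (1 a) then show ?thesis by (cases a) (simp_all add: binary_def)
    next
      case (2 a) then show ?thesis by (cases a) (simp_all add: binary_def)
    qed
    ultimately show ?case using white_projection_symmetry[of R] by metis
  next
    case (add f g)
    then obtain a b a' b' where "white_projection R 2 f = white_projection R 2 (?e a b)"
      "white_projection R 2 g = white_projection R 2 (?e a' b')" by blast
    then have "white_projection R 2 (f + g) = white_projection R 2 (?e a b + ?e a' b')"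
      using add(1,2) c by (simp add: white_projection_add free_operad_simps(1) del: One_nat_def)
    moreover have "?e a b + ?e a' b' = ?e (a + a') (b + b')"
      by (simp add: free_space.scale_left_distrib)
    ultimately show ?case by metis
  next
    case (scale f d)
    then obtain a b where "white_projection R 2 f = white_projection R 2 (?e a b)" by blast
    then have "white_projection R 2 (fscale d f) = white_projection R 2 (fscale d (?e a b))"
      using scale(1) c by (simp add: white_projection_scale free_operad_simps(1) del: One_nat_def)
    moreover have "fscale d (?e a b) = ?e (d * a) (d * b)"
      by (simp add: free_space.scale_right_distrib)
    ultimately show ?case by metis
  qed
qed

section \<open>Alternators and the two test magmas\<close>

definition alternator :: "(nat \<Rightarrow> nat) \<Rightarrow> ('x tree \<Rightarrow>\<^sub>0 'k::field) \<Rightarrow> ('x tree \<Rightarrow>\<^sub>0 'k)" where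
  "alternator \<sigma> f = (let d = free_comp 1 f f + fscale (- 1) (free_comp 2 f f) in d + oact free_operad 3 \<sigma> d)"

lemma alternator_closed:
  assumes "f \<in> ocarrier free_operad 2" "\<sigma> permutes {1..3}"
  shows "alternator \<sigma> f \<in> ocarrier free_operad 3"
proof -
  have "free_comp 1 f f \<in> ocarrier free_operad 3" "free_comp 2 f f \<in> ocarrier free_operad 3"
    using free.comp_closed[of 1 2 f f 2] free.comp_closed[of 2 2 f f 2] assms(1)
    by (simp_all add: free_operad_simps(7))
  then show ?thesis
    unfolding alternator_def Let_def by (intro free_closed free.act_closed assms(2))
qed

text \<open>The alternator is built from the operations of the operad signature, with subtraction as
  scaling by -1. Its image is therefore a function of \<open>\<chi> 2 f\<close> alone, so equal
  images in arity 2 force equal images of the alternators.\<close>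

lemma hom_alternator:
  assumes "operad_hom free_operad T \<chi>" "f \<in> ocarrier free_operad 2" "\<sigma> permutes {1..3}"
  shows "\<chi> 3 (alternator \<sigma> f) =
    (let d = oadd T 3 (ocomp T 2 1 2 (\<chi> 2 f) (\<chi> 2 f)) (oscale T 3 (- 1) (ocomp T 2 2 2 (\<chi> 2 f) (\<chi> 2 f)))
     in oadd T 3 d (oact T 3 \<sigma> d))"
proof -
  note h = operad_homD[OF assms(1), unfolded free_operad_simps(3,4,7)]
  have c: "free_comp 1 f f \<in> ocarrier free_operad 3" "free_comp 2 f f \<in> ocarrier free_operad 3"
    using free.comp_closed[of 1 2 f f 2] free.comp_closed[of 2 2 f f 2] assms(2)
    by (simp_all add: free_operad_simps(7))
  have "\<chi> 3 (free_comp 1 f f) = ocomp T 2 1 2 (\<chi> 2 f) (\<chi> 2 f)"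
    "\<chi> 3 (free_comp 2 f f) = ocomp T 2 2 2 (\<chi> 2 f) (\<chi> 2 f)"
    using h(5)[of f 2 f 2 1] h(5)[of f 2 f 2 2] assms(2) by simp_all
  then show ?thesis
    using c assms(3) by (simp only: alternator_def Let_def h(2,3,4) free_closed free.act_closed)
qed

lemma alternator_generator:
  "alternator (transpose 1 2) (binary () 1 2) = associator 1 2 3 + associator 2 1 3"
  "alternator (transpose 2 3) (binary () 1 2) = associator 1 2 3 + associator 1 3 2"
  by (simp_all add: alternator_def Let_def associator_def binary_def free_operad_simps transpose_def numeral_2_eq_2 numeral_3_eq_3)

lemma flexible_if_associative:
  "(\<And>u v w. c (c u v) w = c u (c v w)) \<Longrightarrow> flexible TYPE('k::field) c"
  by (simp add: flexible_def)

lemma flexible_if_commutative: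
  assumes "\<And>u v. c u v = c v u"
  shows "flexible TYPE('k::field) c"
proof -
  have "c (c u v) w = c w (c v u)" for u v w using assms by metis
  then show ?thesis by (simp add: flexible_def add.commute)
qed

lemma symmetry_identities:
  "binary Succ 1 2 - binary Prec 2 1 \<in> identities (manin_operation c) 2"
  "binary Succ 2 1 - binary Prec 1 2 \<in> identities (manin_operation c) 2"
proof -
  note c = binary_closed[OF refl] binary_closed[OF insert_commute]
  show "binary Succ 1 2 - binary Prec 2 1 \<in> identities (manin_operation c) 2"
    "binary Succ 2 1 - binary Prec 1 2 \<in> identities (manin_operation c) 2"
    by (simp_all add: identities_def free_diff_closed c del: One_nat_def) (simp_all add: binary_def)
qed

lemma alternator_bool:
  fixes a b :: "'k::field"
  defines "e \<equiv> fscale a (binary Prec 1 2) + fscale b (binary Prec 2 1)"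
  assumes "evaluation (manin_operation (\<lambda>u v. u)) (\<lambda>j. j = 1) (alternator (transpose 1 2) e) = 0"
    and "evaluation (manin_operation (\<lambda>u v. \<not> (u \<and> v))) (\<lambda>j. j = 3) (alternator (transpose 2 3) e) = 0"
  shows "a = 0" "b = 0"
proof -
  \<comment> \<open>On the left zero band the new associator of x, y, z is ab(z - x), and the first
    law gives ab(2 x3 - x1 - x2). Only x1 is \<open>True\<close>, so the coefficient read off is
    -ab.\<close>
  have 1: "a * b = 0"
    using arg_cong[OF assms(2), of "\<lambda>f. Poly_Mapping.lookup f True"]
    by (simp add: e_def alternator_def Let_def binary_def evaluation_act transpose_def
        lookup_add lookup_minus lookup_single algebra_simps)
  \<comment> \<open>The magma is commutative, so the new product is a + b times the old one. At
    \<open>False\<close>, \<open>False\<close>, \<open>True\<close> the first associator is (a +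
    b)^2 times \<open>False\<close> minus \<open>True\<close>, while the second one
    vanishes.\<close>
  have 2: "(a + b) * (a + b) = 0"
    using arg_cong[OF assms(3), of "\<lambda>f. Poly_Mapping.lookup f True"]
    by (simp add: e_def alternator_def Let_def binary_def evaluation_act transpose_def
        lookup_add lookup_minus lookup_single algebra_simps neg_eq_iff_add_eq_0)
  show "a = 0" "b = 0" using 1 2 by auto
qed

text \<open>Zero is 0 times any element, so one common value of two morphisms forces equal images of
  zero.\<close>

lemma hom_zero_cong:
  assumes "operad_hom free_operad T \<chi>" "f \<in> ocarrier free_operad n"
    and "operad_hom free_operad T \<psi>" "g \<in> ocarrier free_operad n" and eq: "\<chi> n f = \<psi> n g"
  shows "\<chi> n 0 = \<psi> n 0"
  using operad_homD(3)[OF assms(1,2), of 0] operad_homD(3)[OF assms(3,4), of 0] eq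
  by (simp add: free_operad_simps(4))

lemma quadratic_class_relation:
  assumes "R \<subseteq> ocarrier free_operad 3" "r \<in> R"
  shows "quadratic_class R 3 r = quadratic_class R 3 0"
proof -
  have "(if n = 3 then R else {}) \<subseteq> ocarrier free_operad n" for n using assms(1) by simp
  from free.generated_ideal_superset[of "\<lambda>n. if n = 3 then R else {}", OF this, of 3]
  have "r \<in> quadratic_ideal R 3" using assms(2) by (auto simp: quadratic_ideal_def)
  then show ?thesis
    using quadratic.coset_eq_zero_iff[of r 3 R] assms by (auto simp: quadratic_class_def free_operad_simps(2))
qed

theorem lemma2p7:
  shows "\<not> admits_nonsymmetric_version (alternative_relations :: (unit tree \<Rightarrow>\<^sub>0 'k::field) set)
    \<and> \<not> (white_As_quotient (alternative_relations :: (unit tree \<Rightarrow>\<^sub>0 'k) set)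
          \<cong>\<^sub>o\<^sub>p (Alt :: ('k, (unit tree \<Rightarrow>\<^sub>0 'k) set) operad))"
proof -
  let ?R = "alternative_relations :: (unit tree \<Rightarrow>\<^sub>0 'k) set"
  let ?Q = "white_As_quotient ?R" and ?A = "quadratic_operad ?R"
  let ?e = "\<lambda>a b. fscale a (binary Prec 1 2) + fscale b (binary Prec 2 1) :: manin_label tree \<Rightarrow>\<^sub>0 'k"
  let ?x = "binary () 1 2 :: unit tree \<Rightarrow>\<^sub>0 'k"
  have "\<not> ?Q \<cong>\<^sub>o\<^sub>p ?A"
  proof
    assume "?Q \<cong>\<^sub>o\<^sub>p ?A"
    then obtain \<phi> where hom: "operad_hom ?Q ?A \<phi>"
      and bij: "\<And>n. bij_betw (\<phi> n) (ocarrier ?Q n) (ocarrier ?A n)"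
      unfolding operad_iso_def by blast
    define \<theta> where "\<theta> n f = \<phi> n (white_projection ?R n f)" for n f
    have \<theta>: "operad_hom free_operad ?A \<theta>"
      unfolding \<theta>_def by (rule operad_hom_comp[OF white_projection_hom hom])
    have x: "?x \<in> ocarrier free_operad 2" by (rule binary_closed) simp
    \<comment> \<open>Surjectivity in arity 2 supplies a preimage of the generator of Alt.\<close>
    have "quadratic_class ?R 2 ?x \<in> \<phi> 2 ` ocarrier ?Q 2"
      using bij_betw_imp_surj_on[OF bij] operad_homD(1)[OF quadratic_class_hom x] by simp
    then obtain f where f: "f \<in> ocarrier free_operad 2" "\<theta> 2 f = quadratic_class ?R 2 ?x"
      by (auto simp: \<theta>_def white_projection_carrier)
    obtain a b where "white_projection ?R 2 f = white_projection ?R 2 (?e a b)"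
      using white_projection_arity_2[OF f(1)] by blast
    then have e: "\<theta> 2 (?e a b) = quadratic_class ?R 2 ?x" using f(2) by (simp add: \<theta>_def)
    have ec: "?e a b \<in> ocarrier free_operad 2"
      using generator_combination_closed .
    have zero: "0 \<in> ocarrier free_operad n" for n by (simp add: free_operad_simps)
    \<comment> \<open>An alternator of \<open>?x\<close> that is a defining relation vanishes in
      Alt. Injectivity in arity 3 carries this back to the quotient, and the bound on the kernel
      turns it into an identity of \<open>c\<close>.\<close>
    have ev: "evaluation (manin_operation c) \<rho> (alternator \<sigma> (?e a b)) = 0"
      if \<sigma>: "\<sigma> permutes {1..3}" and R: "alternator \<sigma> ?x \<in> ?R" and c: "flexible TYPE('k) c"
      for \<sigma> and c :: "bool \<Rightarrow> bool \<Rightarrow> bool" and \<rho>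
    proof -
      have ac: "alternator \<sigma> (?e a b) \<in> ocarrier free_operad 3" using ec \<sigma> by (rule alternator_closed)
      have "\<theta> 3 (alternator \<sigma> (?e a b)) = quadratic_class ?R 3 (alternator \<sigma> ?x)"
        unfolding hom_alternator[OF \<theta> ec \<sigma>] hom_alternator[OF quadratic_class_hom x \<sigma>] e ..
      moreover have "quadratic_class ?R 3 (alternator \<sigma> ?x) = quadratic_class ?R 3 0"
        using alternative_relations_closed R by (rule quadratic_class_relation)
      moreover from calculation(1) have "\<theta> 3 0 = quadratic_class ?R 3 0"
        by (rule hom_zero_cong[OF \<theta> ac quadratic_class_hom alternator_closed[OF x \<sigma>]])
      ultimately have "\<phi> 3 (white_projection ?R 3 (alternator \<sigma> (?e a b))) = \<phi> 3 (white_projection ?R 3 0)"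
        by (simp add: \<theta>_def)
      then have "white_projection ?R 3 (alternator \<sigma> (?e a b)) = white_projection ?R 3 0"
        using bij_betw_imp_inj_on[OF bij[of 3]] ac zero
        by (auto simp: inj_on_def white_projection_carrier)
      then have "alternator \<sigma> (?e a b) - 0 \<in> identities (manin_operation c) 3"
        by (rule white_projection_kernel[OF ideal_identities white_relations_identities[OF c]
              symmetry_identities ac zero])
      then show ?thesis by (simp add: identities_def)
    qed
    have "evaluation (manin_operation (\<lambda>u v. u)) (\<lambda>j. j = 1) (alternator (transpose 1 2) (?e a b)) = 0"
      by (rule ev)
        (simp_all add: permutes_swap_id alternator_generator alternative_relations_def flexible_if_associative
          del: One_nat_def)
    moreover have "evaluation (manin_operation (\<lambda>u v. \<not> (u \<and> v))) (\<lambda>j. j = 3) (alternator (transpose 2 3) (?e a b)) = 0"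
    proof (rule ev)
      show "flexible TYPE('k) (\<lambda>u v. \<not> (u \<and> v))" by (rule flexible_if_commutative) auto
    qed (simp_all add: permutes_swap_id alternator_generator alternative_relations_def del: One_nat_def)
    ultimately have "a = 0" "b = 0" by (rule alternator_bool)+
    \<comment> \<open>With both scalars zero the generator of Alt would vanish, although its
      relations begin only in arity 3.\<close>
    then have "quadratic_class ?R 2 ?x = quadratic_class ?R 2 0"
      using e hom_zero_cong[OF \<theta> ec quadratic_class_hom x e] by simp
    then have "?x \<in> quadratic_ideal ?R 2"
      using quadratic.coset_eq_zero_iff[OF x, of ?R] by (simp add: quadratic_class_def free_operad_simps)
    moreover have "quadratic_ideal ?R 2 \<subseteq> {0}"
      by (rule quadratic_ideal_low_arity(2)[where N = "ocarrier free_operad 3"])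
        (use alternative_relations_closed free.add_closed free.scale_closed free.act_closed zero in
          \<open>auto simp: free_operad_simps(3,4)\<close>)
    moreover have "?x \<noteq> 0"
      unfolding binary_def by (metis lookup_single_eq lookup_zero zero_neq_one)
    ultimately show False by blast
  qed
  then show ?thesis by (simp add: admits_nonsymmetric_version_def Alt_def)
qed

end
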